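(* Let $n_1\le n_2$, let $g(X)=\|X\|_*$ be the nuclear norm on $\mathbb{R}^{n_1\times n_2}$, and let $\bar X,\bar Y\in\mathbb{R}^{n_1\times n_2}$ with $\bar Y\in\partial\|\bar X\|_*$. Suppose that $\bar X$ and $\bar Y$ have a simultaneous ordered singular value decomposition with an orthogonal matrix pair $(U,V)\in\mathcal{O}(\bar X)\cap\mathcal{O}(\bar Y)$. Then $$\mathcal{R}_{\partial g^*(\bar Y)}(\bar X)=\left\{U\begin{pmatrix}A&BC&0\\C^TB^T&C&0\\0&0&0\end{pmatrix}V^T\in\mathbb{R}^{n_1\times n_2}\ \middle|\ A\in\mathbb{S}^r,\ B\in\mathbb{R}^{r\times(p-r)},\ C\in\mathbb{S}_+^{p-r}\right\},$$ where $\mathbb{S}^r$ is the set of $r\times r$ symmetric matrices, $\mathbb{S}_+^{p-r}$ is the set of $(p-r)\times(p-r)$ symmetric positive semidefinite matrices, $r=\operatorname{rank}(\bar X)$, and $p=p(\bar Y)=\#\{i\mid\sigma_i(\bar Y)=1\}$.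
   Context: $\mathbb{R}^{n_1\times n_2}$ carries the Frobenius inner product $\langle X,Y\rangle=\operatorname{Tr}(X^TY)$. $\|X\|_*$ is the sum of all singular values of $X$; $\sigma_1(X)\ge\dots\ge\sigma_{n_1}(X)\ge0$ are the singular values in decreasing order. For $X\in\mathbb{R}^{n_1\times n_2}$, $\mathcal{O}(X)$ is the set of all pairs $(U,V)$ of orthogonal matrices $U\in\mathbb{R}^{n_1\times n_1}$, $V\in\mathbb{R}^{n_2\times n_2}$ with $X=U(\operatorname{Diag}\sigma(X))V^T$, where $\operatorname{Diag}\sigma(X)$ is the $n_1\times n_2$ matrix with $\sigma_1(X),\dots,\sigma_{n_1}(X)$ on the main diagonal in this decreasing order and zeros elsewhere. $\bar X$ and $\bar Y$ having a simultaneous ordered SVD with $(U,V)$ means $(U,V)\in\mathcal{O}(\bar X)\cap\mathcal{O}(\bar Y)$. $g^*$ is the Legendre-Fenchel conjugate of $g$ and $\partial g^*(\bar Y)=\{X\mid\bar Y\in\partial\|X\|_*\}$, with $\partial$ the convex subdifferential. For a closed convex set $\Omega$ and $\bar X\in\Omega$, the radial cone is $\mathcal{R}_\Omega(\bar X)=\mathbb{R}_+(\Omega-\bar X)$. *)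

theory Defs
  imports
    "HOL-Library.Extended_Real"
    "Jordan_Normal_Form.Char_Poly"
    "Jordan_Normal_Form.DL_Rank"
begin

definition frob_inner :: "real mat \<Rightarrow> real mat \<Rightarrow> real" where
  "frob_inner X Y = sum_list (diag_mat (X\<^sup>T * Y))"

text \<open>
  Singular values of a matrix with at most as many rows as columns: the square roots of the
  eigenvalues of \<open>X X\<^sup>T\<close>, repeated according to multiplicity, in decreasing order.
  The list is indexed from 0, so \<open>singvals X ! i\<close> is the singular value number \<open>i + 1\<close>.
\<close>

definition singvals :: "real mat \<Rightarrow> real list" where
  "singvals X = rev (sorted_list_of_multiset (image_mset sqrt (proots (char_poly (X * X\<^sup>T)))))"

definition nuclear_norm :: "real mat \<Rightarrow> real" where
  "nuclear_norm X = sum_list (singvals X)"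

definition Diag_singvals :: "real mat \<Rightarrow> real mat" where
  "Diag_singvals X =
     mat (dim_row X) (dim_col X) (\<lambda>(i, j). if i = j then singvals X ! i else 0)"

text \<open>
  The predicate \<open>orthogonal_mat\<close> of the matrix library only asks for pairwise orthogonal columns
  of nonzero length; here the columns have to be orthonormal.
\<close>

definition orthonormal_mats :: "nat \<Rightarrow> real mat set" where
  "orthonormal_mats n = {U \<in> carrier_mat n n. U\<^sup>T * U = 1\<^sub>m n \<and> U * U\<^sup>T = 1\<^sub>m n}"

definition ordered_svds :: "real mat \<Rightarrow> (real mat \<times> real mat) set" where
  "ordered_svds X =
     {(U, V). U \<in> orthonormal_mats (dim_row X) \<and> V \<in> orthonormal_mats (dim_col X) \<and>
              X = U * Diag_singvals X * V\<^sup>T}"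

text \<open>
  Convex analysis on the space of \<open>m \<times> n\<close> matrices with the Frobenius inner product. Only the
  values of a function on \<open>carrier_mat m n\<close> matter. As usual, the subdifferential is empty at
  points where the function is not finite.
\<close>

definition subdifferential ::
    "nat \<Rightarrow> nat \<Rightarrow> (real mat \<Rightarrow> ereal) \<Rightarrow> real mat \<Rightarrow> real mat set" where
  "subdifferential m n f X =
     {W \<in> carrier_mat m n. \<bar>f X\<bar> \<noteq> \<infinity> \<and>
        (\<forall>Z \<in> carrier_mat m n. f Z \<ge> f X + ereal (frob_inner W (Z - X)))}"

definition fenchel_conjugate ::
    "nat \<Rightarrow> nat \<Rightarrow> (real mat \<Rightarrow> ereal) \<Rightarrow> real mat \<Rightarrow> ereal" where
  "fenchel_conjugate m n f Y = (SUP X \<in> carrier_mat m n. ereal (frob_inner Y X) - f X)"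

definition radial_cone :: "real mat set \<Rightarrow> real mat \<Rightarrow> real mat set" where
  "radial_cone \<Omega> X = {t \<cdot>\<^sub>m (W - X) | t W. t \<ge> 0 \<and> W \<in> \<Omega>}"

definition sym_mats :: "nat \<Rightarrow> real mat set" where
  "sym_mats n = {A \<in> carrier_mat n n. A\<^sup>T = A}"

definition psd_mats :: "nat \<Rightarrow> real mat set" where
  "psd_mats n = {C \<in> sym_mats n. \<forall>v \<in> carrier_vec n. v \<bullet> (C *\<^sub>v v) \<ge> 0}"

end

theory Submission
  imports Defs "Jordan_Normal_Form.Spectral_Radius"
begin

text \<open>
  Two facts carry the proof: the subdifferential of the conjugate at \<open>Y\<close> is a linear copy of the
  cone of positive semidefinite \<open>p \<times> p\<close> matrices, and the radial cone of that cone at a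
  diagonal matrix can be computed by completing a square.

  The nuclear norm is dual to the spectral norm. If the rows of \<open>G\<close> are orthogonal with lengths
  \<open>d\<^sub>i\<close> and \<open>P\<close> is orthogonal, then \<open>d\<close> lists the singular values of \<open>P G\<close>, and by the spectral
  theorem for \<open>W W\<^sup>T\<close> every \<open>W\<close> is such a product. Cauchy-Schwarz, applied row by row, gives
  \<open>\<langle>Z, W\<rangle> \<le> \<parallel>W\<parallel>\<^sub>*\<close> for every \<open>Z\<close> in the spectral unit ball, and normalizing the rows of \<open>G\<close> shows
  that the bound is attained. Hence \<open>g\<^sup>*\<close> vanishes on the unit ball, and for \<open>Y\<close> in that ball
  \<open>\<partial>g\<^sup>*(Y) = {W. \<parallel>W\<parallel>\<^sub>* \<le> \<langle>W, Y\<rangle>}\<close> (\<open>subdifferential_conjugate_nuclear_norm\<close>).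

  Both sides of this inequality are unchanged by passing from \<open>W\<close> and \<open>Y\<close> to \<open>M = U\<^sup>T W V\<close> and
  \<open>U\<^sup>T Y V\<close>, so \<open>Y\<close> may be taken to be the rectangular diagonal matrix of its singular values. These are at
  most 1, and exactly the first \<open>p\<close> of them equal 1. Equality in Cauchy-Schwarz for every row
  forces \<open>M = E Y\<close> with \<open>E = (M M\<^sup>T)\<^sup>1\<^sup>/\<^sup>2\<close>, and the range of \<open>E\<close> has to lie where \<open>Y\<close> acts isometrically. So the
  solutions of the inequality are the positive semidefinite \<open>p \<times> p\<close> matrices padded with zeros
  (\<open>nuclear_norm_le_frob_inner_rect_diag\<close>).

  In the same coordinates \<open>X\<close> is the padded diagonal matrix \<open>\<Sigma>\<close> with positive entries in the
  first \<open>r\<close> places and zeros afterwards; \<open>r \<le> p\<close> because \<open>\<sigma>\<^sub>i(X) > 0\<close> implies \<open>\<sigma>\<^sub>i(Y) = 1\<close>. A direction \<open>M\<close> with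
  blocks \<open>A, D, D\<^sup>T, C\<close> is feasible at \<open>\<Sigma>\<close> if and only if \<open>C\<close> is positive semidefinite and \<open>D = B C\<close> for
  some \<open>B\<close>. The kernel of the lower right block of a positive semidefinite matrix is annihilated by the upper right block,
  which gives necessity. Conversely, the quadratic form of \<open>\<Sigma> + \<epsilon> M\<close> at \<open>(x, z)\<close> is
  \<open>x\<^sup>T (\<Sigma>\<^sub>r + \<epsilon> (A - B C B\<^sup>T)) x + \<epsilon> (z + B\<^sup>T x)\<^sup>T C (z + B\<^sup>T x)\<close>, where \<open>\<Sigma>\<^sub>r\<close> is the leading
  \<open>r \<times> r\<close> block of \<open>\<Sigma>\<close>; for small \<open>\<epsilon>\<close> this is nonnegative (\<open>radial_cone_psd_mats\<close>).
\<close>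

section \<open>Orthonormal matrices\<close>

lemma dim_mat_diag [simp]: "dim_row (mat_diag n f) = n" "dim_col (mat_diag n f) = n"
  by (auto simp: mat_diag_def)

lemma index_mat_diag [simp]:
  "i < n \<Longrightarrow> j < n \<Longrightarrow> mat_diag n f $$ (i,j) = (if i = j then f j else 0)"
  by (simp add: mat_diag_def)

lemma orthonormal_matsD:
  assumes "P \<in> orthonormal_mats n"
  shows "P \<in> carrier_mat n n" "P\<^sup>T \<in> carrier_mat n n" "P\<^sup>T * P = 1\<^sub>m n" "P * P\<^sup>T = 1\<^sub>m n"
  using assms by (auto simp: orthonormal_mats_def)

lemma orthonormal_mats_transpose:
  "P \<in> orthonormal_mats n \<Longrightarrow> P\<^sup>T \<in> orthonormal_mats n"
  by (auto simp: orthonormal_mats_def)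

lemma orthonormal_cancel:
  assumes "P \<in> orthonormal_mats n" and "A \<in> carrier_mat n m"
  shows "P\<^sup>T * (P * A) = A" "P * (P\<^sup>T * A) = A"
proof -
  note P = orthonormal_matsD[OF assms(1)]
  show "P\<^sup>T * (P * A) = A"
    using assoc_mult_mat[OF P(2) P(1) assms(2)] P assms(2) by simp
  show "P * (P\<^sup>T * A) = A"
    using assoc_mult_mat[OF P(1) P(2) assms(2)] P assms(2) by simp
qed

lemma orthonormal_mats_mult:
  assumes "P \<in> orthonormal_mats n" "Q \<in> orthonormal_mats n"
  shows "P * Q \<in> orthonormal_mats n"
proof -
  note P = orthonormal_matsD[OF assms(1)] and Q = orthonormal_matsD[OF assms(2)]
  have "(P * Q)\<^sup>T * (P * Q) = Q\<^sup>T * (P\<^sup>T * (P * Q))"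
    using P Q by (simp add: transpose_mult[OF P(1) Q(1)] assoc_mult_mat[of _ n n _ n _ n])
  moreover have "(P * Q) * (P * Q)\<^sup>T = P * (Q * (Q\<^sup>T * P\<^sup>T))"
    using P Q by (simp add: transpose_mult[OF P(1) Q(1)] assoc_mult_mat[of _ n n _ n _ n])
  ultimately show ?thesis
    using P Q orthonormal_cancel[OF assms(1) Q(1)] orthonormal_cancel[OF assms(2) P(2)]
    by (simp add: orthonormal_mats_def)
qed

lemma orthonormal_block:
  assumes "P \<in> orthonormal_mats a" "Q \<in> orthonormal_mats b"
  shows "four_block_mat P (0\<^sub>m a b) (0\<^sub>m b a) Q \<in> orthonormal_mats (a + b)"
proof -
  let ?K = "four_block_mat P (0\<^sub>m a b) (0\<^sub>m b a) Q"
  note P = orthonormal_matsD[OF assms(1)] and Q = orthonormal_matsD[OF assms(2)]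
  have KT: "?K\<^sup>T = four_block_mat (P\<^sup>T) (0\<^sub>m a b) (0\<^sub>m b a) (Q\<^sup>T)"
    using P Q by (subst transpose_four_block_mat) auto
  have "?K\<^sup>T * ?K = 1\<^sub>m (a + b)" unfolding KT
    using P Q by (subst mult_four_block_mat[of _ a a _ b _ b _ _ a _ b]) auto
  moreover have "?K * ?K\<^sup>T = 1\<^sub>m (a + b)" unfolding KT
    using P Q by (subst mult_four_block_mat[of _ a a _ b _ b _ _ a _ b]) auto
  ultimately show ?thesis using P Q by (auto simp: orthonormal_mats_def)
qed

section \<open>The spectral theorem for real symmetric matrices\<close>

text \<open>
  Over the complex numbers an eigenvector \<open>a + \<i> b\<close> exists. Comparing \<open>a \<bullet> A b\<close> with
  \<open>A a \<bullet> b\<close> shows that the eigenvalue is real, so \<open>a\<close> and \<open>b\<close> both satisfy the real eigenvalue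
  equation, and at least one of them can be normalized.
\<close>

lemma symmetric_real_eigenvector:
  fixes A :: "real mat"
  assumes A: "A \<in> carrier_mat n n" and sym: "A\<^sup>T = A" and n: "n > 0"
  shows "\<exists>v k. v \<in> carrier_vec n \<and> v \<bullet> v = 1 \<and> A *\<^sub>v v = k \<cdot>\<^sub>v v"
proof -
  let ?A = "map_mat complex_of_real A"
  have Ac: "?A \<in> carrier_mat n n" using A by simp
  from spectrum_non_empty[OF Ac n] obtain l x where
    x: "x \<in> carrier_vec n" "x \<noteq> 0\<^sub>v n" "?A *\<^sub>v x = l \<cdot>\<^sub>v x"
    using A by (auto simp: spectrum_def eigenvalue_def eigenvector_def)
  define a where "a = map_vec Re x"
  define b where "b = map_vec Im x"
  have ab: "a \<in> carrier_vec n" "b \<in> carrier_vec n" using x by (auto simp: a_def b_def)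
  have comp: "(\<Sum>j<n. complex_of_real (A $$ (i,j)) * x $ j) = l * x $ i" if "i < n" for i
    using arg_cong[OF x(3), of "\<lambda>v. v $ i"] that x(1) A
    by (simp add: scalar_prod_def atLeast0LessThan)
  have Aa: "A *\<^sub>v a = Re l \<cdot>\<^sub>v a - Im l \<cdot>\<^sub>v b"
  proof (rule eq_vecI)
    fix i assume "i < dim_vec (Re l \<cdot>\<^sub>v a - Im l \<cdot>\<^sub>v b)"
    hence i: "i < n" using ab by simp
    show "(A *\<^sub>v a) $ i = (Re l \<cdot>\<^sub>v a - Im l \<cdot>\<^sub>v b) $ i"
      using arg_cong[OF comp[OF i], of Re] i A x(1)
      by (simp add: scalar_prod_def atLeast0LessThan a_def b_def)
  qed (use A ab in auto)
  have Ab: "A *\<^sub>v b = Re l \<cdot>\<^sub>v b + Im l \<cdot>\<^sub>v a"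
  proof (rule eq_vecI)
    fix i assume "i < dim_vec (Re l \<cdot>\<^sub>v b + Im l \<cdot>\<^sub>v a)"
    hence i: "i < n" using ab by simp
    show "(A *\<^sub>v b) $ i = (Re l \<cdot>\<^sub>v b + Im l \<cdot>\<^sub>v a) $ i"
      using arg_cong[OF comp[OF i], of Im] i A x(1)
      by (simp add: scalar_prod_def atLeast0LessThan a_def b_def)
  qed (use A ab in auto)
  have "a \<bullet> (A *\<^sub>v b) = (A *\<^sub>v a) \<bullet> b"
    using transpose_vec_mult_scalar[OF A ab(2,1)] sym by simp
  hence "Im l * (a \<bullet> a + b \<bullet> b) = 0"
    using ab by (simp add: Aa Ab scalar_prod_add_distrib[of _ n] minus_scalar_prod_distrib[of _ n]
        comm_scalar_prod[of b n a] algebra_simps)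
  moreover have sq: "v \<bullet> v > 0" if "v \<in> carrier_vec n" "v \<noteq> 0\<^sub>v n" for v :: "real vec"
  proof -
    from that obtain i where i: "i < n" "v $ i \<noteq> 0" by (metis eq_vecI carrier_vecD index_zero_vec)
    have "v \<bullet> v = (\<Sum>i<n. v $ i * v $ i)"
      using that(1) by (simp add: scalar_prod_def atLeast0LessThan)
    also have "\<dots> > 0" using i by (intro sum_pos2[of _ i]) (auto simp: zero_less_mult_iff linorder_neq_iff)
    finally show ?thesis .
  qed
  moreover have "a \<noteq> 0\<^sub>v n \<or> b \<noteq> 0\<^sub>v n"
  proof (rule ccontr)
    assume "\<not> ?thesis"
    hence "a $ i = 0" "b $ i = 0" if "i < n" for i using that by auto
    hence "x = 0\<^sub>v n" using x(1) by (auto simp: a_def b_def complex_eq_iff)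
    thus False using x(2) by simp
  qed
  moreover have "a \<bullet> a \<ge> 0" "b \<bullet> b \<ge> 0" by (auto simp: scalar_prod_def intro!: sum_nonneg)
  ultimately have "Im l = 0"
    using sq[OF ab(1)] sq[OF ab(2)] by (auto simp: add_nonneg_eq_0_iff)
  hence "A *\<^sub>v a = Re l \<cdot>\<^sub>v a" "A *\<^sub>v b = Re l \<cdot>\<^sub>v b"
    using Aa Ab ab by auto
  with \<open>a \<noteq> 0\<^sub>v n \<or> b \<noteq> 0\<^sub>v n\<close> ab obtain w where
    w: "w \<in> carrier_vec n" "w \<noteq> 0\<^sub>v n" "A *\<^sub>v w = Re l \<cdot>\<^sub>v w" by blast
  define c where "c = 1 / sqrt (w \<bullet> w)"
  have c: "c * c * (w \<bullet> w) = 1" using sq[OF w(1,2)] by (simp add: c_def)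
  have "(c \<cdot>\<^sub>v w) \<bullet> (c \<cdot>\<^sub>v w) = 1" using w(1) c by (simp add: mult.assoc)
  moreover have "A *\<^sub>v (c \<cdot>\<^sub>v w) = Re l \<cdot>\<^sub>v (c \<cdot>\<^sub>v w)"
    using w A by (simp add: mult_mat_vec smult_smult_assoc mult.commute)
  ultimately show ?thesis using w(1) by (intro exI[of _ "c \<cdot>\<^sub>v w"] exI[of _ "Re l"]) simp
qed

text \<open>
  For \<open>v \<noteq> e\<^sub>0\<close> the Householder reflection in the hyperplane orthogonal to \<open>v - e\<^sub>0\<close> exchanges the
  unit vectors \<open>e\<^sub>0\<close> and \<open>v\<close>.
\<close>

lemma orthonormal_mat_first_column:
  assumes v: "v \<in> carrier_vec n" and n: "n > 0" and unit: "v \<bullet> v = (1::real)"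
  shows "\<exists>H \<in> orthonormal_mats n. col H 0 = v"
proof -
  define w where "w = (\<lambda>i. v $ i - (if i = 0 then 1 else 0))"
  (* For v = e_0 the vector w is zero. Division by zero then gives c = 0, and H is the identity. *)
  define c where "c = 1 / (1 - v $ 0)"
  define H where "H = mat n n (\<lambda>(i,j). (if i = j then 1 else 0) - c * w i * w j)"
  have vv: "(\<Sum>i<n. v $ i * v $ i) = 1"
    using unit v by (simp add: scalar_prod_def atLeast0LessThan)
  have ww: "(\<Sum>i<n. w i * w i) = 2 - 2 * v $ 0"
  proof -
    have "(\<Sum>i<n. w i * w i) = (\<Sum>i<n. v $ i * v $ i + (if i = 0 then 1 - 2 * v $ 0 else 0))"
      by (intro sum.cong) (auto simp: w_def algebra_simps)
    also have "\<dots> = 2 - 2 * v $ 0"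
      using n by (simp add: sum.distrib vv)
    finally show ?thesis .
  qed
  (* Unless c = 0, this says c (w, w) = 2, the condition for H to be an involution. *)
  have cw: "c * c * w i * w j * (\<Sum>k<n. w k * w k) = 2 * c * w i * w j" for i j
  proof (cases "v $ 0 = 1")
    case False
    hence "c * (2 - 2 * v $ 0) = 2" by (simp add: c_def field_simps)
    thus ?thesis by (simp add: ww) algebra
  qed (simp add: c_def)
  have HT: "H\<^sup>T = H" by (rule eq_matI) (auto simp: H_def)
  have HH: "H * H = 1\<^sub>m n"
  proof (rule eq_matI)
    fix i j assume ij: "i < dim_row (1\<^sub>m n)" "j < dim_col (1\<^sub>m n)"
    have "(H * H) $$ (i,j) = (\<Sum>k<n. ((if i = k then 1 else 0) - c * w i * w k) *
       ((if k = j then 1 else 0) - c * w k * w j))"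
      using ij by (simp add: H_def scalar_prod_def atLeast0LessThan)
    also have "\<dots> = (\<Sum>k<n. (if k = i then (if i = j then 1 else 0) - c * w i * w j else 0)
        - (if k = j then c * w i * w j else 0) + c * c * w i * w j * (w k * w k))"
      by (intro sum.cong) (auto simp: algebra_simps)
    also have "\<dots> = (if i = j then 1 else 0) - 2 * c * w i * w j
        + c * c * w i * w j * (\<Sum>k<n. w k * w k)"
      using ij by (simp add: sum.distrib sum_subtractf sum_distrib_left)
    finally show "(H * H) $$ (i,j) = 1\<^sub>m n $$ (i,j)" using ij cw by simp
  qed (auto simp: H_def)
  have "col H 0 = v"
  proof (rule eq_vecI)
    fix i assume "i < dim_vec v"
    hence i: "i < n" using v by simp
    show "col H 0 $ i = v $ i"
    proof (cases "v $ 0 = 1")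
      case False
      hence "c * w i * w 0 = - w i" by (simp add: c_def w_def field_simps)
      thus ?thesis using i n by (simp add: H_def w_def)
    next
      case True
      hence "\<forall>k\<in>{..<n}. w k * w k = 0"
        using ww by (subst sum_nonneg_eq_0_iff[symmetric]) auto
      hence "w i = 0" using i by auto
      thus ?thesis using i n by (simp add: H_def w_def)
    qed
  qed (use v in \<open>auto simp: H_def\<close>)
  moreover have "H \<in> orthonormal_mats n"
    using HT HH by (auto simp: orthonormal_mats_def) (auto simp: H_def)
  ultimately show ?thesis by blast
qed

text \<open>
  Induction on the dimension: in an orthonormal basis that starts with a unit eigenvector, symmetry
  makes the first row vanish together with the first column away from the diagonal, which leaves a
  symmetric block of one dimension less.
\<close>

theorem real_spectral_theorem:
  fixes A :: "real mat"
  assumes "A \<in> carrier_mat n n" and "A\<^sup>T = A"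
  shows "\<exists>P \<in> orthonormal_mats n. \<exists>d. A = P * mat_diag n d * P\<^sup>T"
  using assms
proof (induction n arbitrary: A)
  case 0
  thus ?case by (intro bexI[of _ "1\<^sub>m 0"] exI[of _ "\<lambda>_. 0"]) (auto simp: orthonormal_mats_def)
next
  case (Suc m)
  note A = Suc.prems(1)
  from symmetric_real_eigenvector[OF Suc.prems] obtain v k where
    v: "v \<in> carrier_vec (Suc m)" "v \<bullet> v = 1" "A *\<^sub>v v = k \<cdot>\<^sub>v v" by auto
  from orthonormal_mat_first_column[OF v(1) _ v(2)] obtain H where
    HO: "H \<in> orthonormal_mats (Suc m)" and Hv: "col H 0 = v" by auto
  note H = orthonormal_matsD[OF HO]
  define B where "B = H\<^sup>T * (A * H)"
  have B: "B \<in> carrier_mat (Suc m) (Suc m)" using A H by (auto simp: B_def)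
  have BT: "B\<^sup>T = B"
    using A H Suc.prems(2)
    by (simp add: B_def transpose_mult[of _ "Suc m" "Suc m" _ "Suc m"])
  have B0: "B $$ (i,0) = (if i = 0 then k else 0)" if i: "i < Suc m" for i
  proof -
    have "col B 0 = H\<^sup>T *\<^sub>v (A *\<^sub>v v)"
      unfolding B_def Hv[symmetric] using A H
      by (subst col_mult2[of _ "Suc m" "Suc m" _ "Suc m"],
          simp_all add: col_mult2[of A "Suc m" "Suc m" H "Suc m" 0] del: col_mult)
    also have "\<dots> = k \<cdot>\<^sub>v (H\<^sup>T *\<^sub>v col H 0)" using H v Hv by (simp add: mult_mat_vec)
    also have "H\<^sup>T *\<^sub>v col H 0 = col (H\<^sup>T * H) 0" by (rule col_mult2[OF H(2,1), symmetric]) simp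
    also have "\<dots> = unit_vec (Suc m) 0" using H by simp
    finally have "col B 0 $ i = (k \<cdot>\<^sub>v unit_vec (Suc m) 0) $ i" by simp
    thus ?thesis using B i by simp
  qed
  define C where "C = mat m m (\<lambda>(i,j). B $$ (Suc i, Suc j))"
  have C: "C \<in> carrier_mat m m" by (simp add: C_def)
  have Bsym: "B $$ (i,j) = B $$ (j,i)" if "i < Suc m" "j < Suc m" for i j
    using arg_cong[OF BT, of "\<lambda>M. M $$ (j,i)"] that B by simp
  have "C\<^sup>T = C" by (rule eq_matI) (auto simp: C_def intro: Bsym)
  from Suc.IH[OF C this] obtain Q d where QO: "Q \<in> orthonormal_mats m"
    and Cd: "C = Q * mat_diag m d * Q\<^sup>T" by blast
  note Q = orthonormal_matsD[OF QO]
  define K where "K = four_block_mat (1\<^sub>m 1) (0\<^sub>m 1 m) (0\<^sub>m m 1) Q"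
  define e where "e = (\<lambda>i. case i of 0 \<Rightarrow> k | Suc i \<Rightarrow> d i)"
  have K: "K \<in> carrier_mat (Suc m) (Suc m)" using Q by (auto simp: K_def)
  have KT: "K\<^sup>T = four_block_mat (1\<^sub>m 1) (0\<^sub>m 1 m) (0\<^sub>m m 1) (Q\<^sup>T)"
    unfolding K_def using Q by (subst transpose_four_block_mat) auto
  have KO: "K \<in> orthonormal_mats (Suc m)"
    using orthonormal_block[OF _ QO, of "1\<^sub>m 1" 1] by (simp add: K_def orthonormal_mats_def)
  have De: "mat_diag (Suc m) e = four_block_mat (mat_diag 1 (\<lambda>_. k)) (0\<^sub>m 1 m) (0\<^sub>m m 1) (mat_diag m d)"
    by (rule eq_matI) (auto simp: mat_diag_def e_def split: nat.splits)
  have "K * mat_diag (Suc m) e = four_block_mat (mat_diag 1 (\<lambda>_. k)) (0\<^sub>m 1 m) (0\<^sub>m m 1) (Q * mat_diag m d)"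
    unfolding De K_def using Q by (subst mult_four_block_mat[of _ 1 1 _ m _ m _ _ 1 _ m]) auto
  hence "K * mat_diag (Suc m) e * K\<^sup>T = four_block_mat (mat_diag 1 (\<lambda>_. k)) (0\<^sub>m 1 m) (0\<^sub>m m 1) C"
    unfolding KT Cd using Q mult_carrier_mat[OF mult_carrier_mat[OF Q(1) mat_diag_dim[of m d]] Q(2)]
    by (simp add: mult_four_block_mat[of _ 1 1 _ m _ m _ _ 1 _ m] left_add_zero_mat)
  also have "\<dots> = B"
  proof (rule eq_matI)
    fix i j assume "i < dim_row B" "j < dim_col B"
    hence ij: "i < Suc m" "j < Suc m" using B by auto
    show "four_block_mat (mat_diag 1 (\<lambda>_. k)) (0\<^sub>m 1 m) (0\<^sub>m m 1) C $$ (i,j) = B $$ (i,j)"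
      using ij B0[OF ij(1)] B0[OF ij(2)] Bsym[OF ij]
      by (cases i; cases j) (auto simp: C_def mat_diag_def)
  qed (use B in \<open>auto simp: C_def mat_diag_def\<close>)
  finally have BK: "K * mat_diag (Suc m) e * K\<^sup>T = B" .
  note HK = orthonormal_matsD[OF orthonormal_mats_mult[OF HO KO]]
  have KTc: "K\<^sup>T \<in> carrier_mat (Suc m) (Suc m)" using K by simp
  let ?D = "mat_diag (Suc m) e"
  have "(H * K) * ?D * (H * K)\<^sup>T = H * (K * ?D * K\<^sup>T) * H\<^sup>T"
    using H K KTc
    by (simp add: transpose_mult[OF H(1) K] assoc_mult_mat[of _ "Suc m" "Suc m" _ "Suc m" _ "Suc m"]
        mult_carrier_mat[of _ "Suc m" "Suc m" _ "Suc m"])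
  also have "\<dots> = H * (H\<^sup>T * (A * H)) * H\<^sup>T" by (simp add: BK B_def)
  also have "\<dots> = A * H * H\<^sup>T"
    using orthonormal_cancel(2)[OF HO, of "A * H" "Suc m"] A H by simp
  also have "\<dots> = A" using A H by (simp add: assoc_mult_mat[of _ "Suc m" "Suc m" _ "Suc m" _ "Suc m"])
  finally show ?case using orthonormal_mats_mult[OF HO KO] by metis
qed

section \<open>Singular values and the nuclear norm\<close>

lemma mult_transpose_index:
  assumes "G \<in> carrier_mat n m" "H \<in> carrier_mat k m" "i < n" "j < k"
  shows "(G * H\<^sup>T) $$ (i,j) = (\<Sum>l<m. G $$ (i,l) * H $$ (j,l))"
  using assms by (simp add: scalar_prod_def atLeast0LessThan)

lemma sum_sq_rows:
  fixes G :: "real mat"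
  assumes "G \<in> carrier_mat n m" "G * G\<^sup>T = mat_diag n e" "i < n"
  shows "(\<Sum>j<m. (G $$ (i,j))\<^sup>2) = e i"
proof -
  have "e i = (G * G\<^sup>T) $$ (i,i)" using assms(2,3) by simp
  also have "\<dots> = (\<Sum>j<m. (G $$ (i,j))\<^sup>2)"
    unfolding mult_transpose_index[OF assms(1,1,3,3)] power2_eq_square by (rule refl)
  finally show ?thesis ..
qed

lemma orthonormal_row_sum:
  assumes "R \<in> orthonormal_mats n" "i < n"
  shows "(\<Sum>k<n. (R $$ (i,k))\<^sup>2) = 1"
  using sum_sq_rows[of R n n "\<lambda>_. 1" i] orthonormal_matsD[OF assms(1)] assms(2) by simp

lemma mult_mult_transpose_orthonormal:
  assumes "P \<in> orthonormal_mats n" "Q \<in> orthonormal_mats m" "G \<in> carrier_mat n m"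
  shows "(P * G * Q\<^sup>T) * (P * G * Q\<^sup>T)\<^sup>T = P * (G * G\<^sup>T) * P\<^sup>T"
proof -
  note P = orthonormal_matsD[OF assms(1)] and Q = orthonormal_matsD[OF assms(2)]
  have GT: "G\<^sup>T \<in> carrier_mat m n" and PG: "P * G \<in> carrier_mat n m"
    using assms(3) P by auto
  have "(P * G * Q\<^sup>T)\<^sup>T = Q * (G\<^sup>T * P\<^sup>T)"
    using transpose_mult[OF PG Q(2)] transpose_mult[OF P(1) assms(3)] by simp
  hence "(P * G * Q\<^sup>T) * (P * G * Q\<^sup>T)\<^sup>T = P * G * (Q\<^sup>T * (Q * (G\<^sup>T * P\<^sup>T)))"
    using assoc_mult_mat[OF PG Q(2), of "Q * (G\<^sup>T * P\<^sup>T)" n] GT P Q by simp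
  also have "\<dots> = P * G * (G\<^sup>T * P\<^sup>T)"
    using orthonormal_cancel(1)[OF assms(2), of "G\<^sup>T * P\<^sup>T" n] GT P by simp
  also have "\<dots> = P * (G * G\<^sup>T) * P\<^sup>T"
    using assoc_mult_mat[OF PG GT P(2)] assoc_mult_mat[OF P(1) assms(3) GT] by simp
  finally show ?thesis .
qed

lemma orthonormal_similar:
  assumes "P \<in> orthonormal_mats n" "A \<in> carrier_mat n n"
  shows "similar_mat (P * A * P\<^sup>T) A"
  using orthonormal_matsD[OF assms(1)] assms(2)
  by (intro similar_matI[of _ _ P "P\<^sup>T" n]) auto

lemma singvals_orthonormal_mult:
  assumes "U \<in> orthonormal_mats n" "V \<in> orthonormal_mats m" "M \<in> carrier_mat n m"
  shows "singvals (U * M * V\<^sup>T) = singvals M"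
  unfolding singvals_def mult_mult_transpose_orthonormal[OF assms]
  using char_poly_similar[OF orthonormal_similar[OF assms(1), of "M * M\<^sup>T"]] assms(3) by simp

lemma proots_prod_linear_factors:
  fixes as :: "'a::idom list"
  shows "proots (\<Prod>a\<leftarrow>as. [:- a, 1:]) = mset as"
proof (induction as)
  case (Cons a as)
  have "(\<Prod>a\<leftarrow>as. [:- a, 1:]) \<noteq> 0" by (simp add: prod_list_zero_iff image_iff)
  hence "proots ([:- a, 1:] * (\<Prod>a\<leftarrow>as. [:- a, 1:])) = {#a#} + mset as"
    using Cons.IH by (subst proots_mult) auto
  thus ?case by simp
qed simp

text \<open>
  This is how singular values are computed from here on: \<open>P G\<close> is a singular value decomposition
  whose right factor is not normalized. Zero rows of \<open>G\<close> then need no special treatment, and no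
  right singular vectors have to be chosen for them.
\<close>

lemma mset_singvals:
  assumes P: "P \<in> orthonormal_mats n" and G: "G \<in> carrier_mat n m"
    and GG: "G * G\<^sup>T = mat_diag n (\<lambda>i. (d i)\<^sup>2)" and d: "\<And>i. i < n \<Longrightarrow> 0 \<le> d i"
  shows "mset (singvals (P * G)) = mset (map d [0..<n])"
proof -
  have one: "1\<^sub>m m \<in> orthonormal_mats m" by (auto simp: orthonormal_mats_def)
  have "singvals (P * G) = singvals G"
    using singvals_orthonormal_mult[OF P one G] G orthonormal_matsD[OF P] by simp
  moreover have "proots (char_poly (G * G\<^sup>T)) = mset (map (\<lambda>i. (d i)\<^sup>2) [0..<n])"
  proof -
    have "diag_mat (mat_diag n (\<lambda>i. (d i)\<^sup>2)) = map (\<lambda>i. (d i)\<^sup>2) [0..<n]"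
      by (auto simp: diag_mat_def)
    hence "char_poly (G * G\<^sup>T) = (\<Prod>a\<leftarrow>map (\<lambda>i. (d i)\<^sup>2) [0..<n]. [:- a, 1:])"
      unfolding GG using char_poly_upper_triangular[OF mat_diag_dim, of n "\<lambda>i. (d i)\<^sup>2"]
      by (simp add: upper_triangular_def)
    thus ?thesis by (simp only: proots_prod_linear_factors)
  qed
  moreover have "image_mset sqrt (mset (map (\<lambda>i. (d i)\<^sup>2) [0..<n])) = mset (map d [0..<n])"
    using d by (auto simp flip: mset_map intro!: arg_cong[of _ _ mset])
  ultimately show ?thesis by (simp add: singvals_def)
qed

lemma nuclear_norm_eq_sum:
  assumes "P \<in> orthonormal_mats n" "G \<in> carrier_mat n m"
    and "G * G\<^sup>T = mat_diag n (\<lambda>i. (d i)\<^sup>2)" "\<And>i. i < n \<Longrightarrow> 0 \<le> d i"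
  shows "nuclear_norm (P * G) = (\<Sum>i<n. d i)"
proof -
  have "nuclear_norm (P * G) = sum_mset (mset (singvals (P * G)))"
    by (simp only: nuclear_norm_def sum_mset_sum_list)
  also have "\<dots> = sum_list (map d [0..<n])"
    using mset_singvals[of P n G m d, OF assms] by (simp only: sum_mset_sum_list)
  also have "\<dots> = (\<Sum>i<n. d i)"
    by (simp only: interv_sum_list_conv_sum_set_nat set_upt atLeast0LessThan)
  finally show ?thesis .
qed

text \<open>
  If \<open>P\<close> diagonalizes \<open>W W\<^sup>T\<close>, then the rows of \<open>P\<^sup>T W\<close> are pairwise orthogonal, and the eigenvalues
  are their squared lengths.
\<close>

lemma orthogonal_rows_decomposition:
  assumes W: "W \<in> carrier_mat n m"
  obtains P G d where "P \<in> orthonormal_mats n" "G \<in> carrier_mat n m" "W = P * G"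
    "G * G\<^sup>T = mat_diag n (\<lambda>i. (d i)\<^sup>2)" "\<forall>i. 0 \<le> d i"
proof -
  have WW: "W * W\<^sup>T \<in> carrier_mat n n" and "(W * W\<^sup>T)\<^sup>T = W * W\<^sup>T"
    using W by (auto simp: transpose_mult[of W n m "W\<^sup>T" n])
  from real_spectral_theorem[OF this] obtain P e where
    P: "P \<in> orthonormal_mats n" and e: "W * W\<^sup>T = P * mat_diag n e * P\<^sup>T" by blast
  note PD = orthonormal_matsD[OF P]
  define G where "G = P\<^sup>T * W"
  have G: "G \<in> carrier_mat n m" using W PD by (auto simp: G_def)
  have "G * G\<^sup>T = P\<^sup>T * (W * W\<^sup>T) * P"
    using mult_mult_transpose_orthonormal[OF orthonormal_mats_transpose[OF P] _ W, of "1\<^sub>m m"] W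
    by (simp add: G_def orthonormal_mats_def)
  also have "\<dots> = P\<^sup>T * (P * (mat_diag n e * P\<^sup>T)) * P"
    using PD by (simp add: e assoc_mult_mat[OF PD(1) mat_diag_dim PD(2)])
  also have "\<dots> = mat_diag n e * P\<^sup>T * P"
    using orthonormal_cancel(1)[OF P mult_carrier_mat[OF mat_diag_dim PD(2)]] by simp
  also have "\<dots> = mat_diag n e"
    using PD by (simp add: assoc_mult_mat[OF mat_diag_dim PD(2) PD(1)])
  finally have GG: "G * G\<^sup>T = mat_diag n e" .
  have "e i \<ge> 0" if "i < n" for i
  proof -
    have "e i = (\<Sum>l<m. G $$ (i,l) * G $$ (i,l))"
      using mult_transpose_index[OF G G that that] that by (simp add: GG mat_diag_def)
    thus ?thesis by (simp add: sum_nonneg)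
  qed
  hence "mat_diag n e = mat_diag n (\<lambda>i. (sqrt \<bar>e i\<bar>)\<^sup>2)"
    by (intro eq_matI) auto
  moreover have "W = P * G" unfolding G_def by (rule orthonormal_cancel(2)[OF P W, symmetric])
  ultimately show ?thesis
    using GG by (intro that[of P G "\<lambda>i. sqrt \<bar>e i\<bar>"] P G) auto
qed

lemma singvals_basic:
  assumes "W \<in> carrier_mat n m"
  shows length_singvals: "length (singvals W) = n"
    and singvals_nonneg: "i < n \<Longrightarrow> 0 \<le> singvals W ! i"
proof -
  obtain P G d where d: "P \<in> orthonormal_mats n" "G \<in> carrier_mat n m" "W = P * G"
    "G * G\<^sup>T = mat_diag n (\<lambda>i. (d i)\<^sup>2)" "\<forall>i. 0 \<le> d i"
    by (rule orthogonal_rows_decomposition[OF assms])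
  have m: "mset (singvals W) = mset (map d [0..<n])"
    unfolding d(3) by (rule mset_singvals[OF d(1,2,4)]) (simp add: d(5))
  show l: "length (singvals W) = n" using mset_eq_length[OF m] by simp
  show "0 \<le> singvals W ! i" if "i < n"
  proof -
    have "singvals W ! i \<in> set (map d [0..<n])"
      unfolding mset_eq_setD[OF m, symmetric] by (rule nth_mem) (simp add: l that)
    thus ?thesis using d(5) by auto
  qed
qed

lemma singvals_antimono:
  assumes "W \<in> carrier_mat n m" "i \<le> j" "j < n"
  shows "singvals W ! j \<le> singvals W ! i"
proof -
  have "sorted (rev (singvals W))" by (simp add: singvals_def)
  thus ?thesis using sorted_rev_nth_mono[of "singvals W" i j] assms length_singvals[OF assms(1)]
    by simp
qed

lemma nuclear_norm_zero: "nuclear_norm (0\<^sub>m n m) = 0"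
proof -
  have "(0\<^sub>m n m :: real mat) * (0\<^sub>m n m)\<^sup>T = mat_diag n (\<lambda>i. 0\<^sup>2)"
    by (rule eq_matI) (auto simp: mat_diag_def)
  from nuclear_norm_eq_sum[OF _ zero_carrier_mat this, of "1\<^sub>m n"] show ?thesis
    by (simp add: orthonormal_mats_def)
qed

section \<open>The Frobenius inner product\<close>

lemma frob_inner_sum:
  assumes "A \<in> carrier_mat n m" "B \<in> carrier_mat n m"
  shows "frob_inner A B = (\<Sum>i<n. \<Sum>j<m. A $$ (i,j) * B $$ (i,j))"
proof -
  have "frob_inner A B = (\<Sum>j<m. \<Sum>i<n. A $$ (i,j) * B $$ (i,j))"
    using assms by (simp add: frob_inner_def diag_mat_def interv_sum_list_conv_sum_set_nat
        atLeast0LessThan scalar_prod_def)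
  also have "\<dots> = (\<Sum>i<n. \<Sum>j<m. A $$ (i,j) * B $$ (i,j))" by (rule sum.swap)
  finally show ?thesis .
qed

lemma frob_inner_commute:
  assumes "A \<in> carrier_mat n m" "B \<in> carrier_mat n m"
  shows "frob_inner A B = frob_inner B A"
  by (simp add: frob_inner_sum[OF assms] frob_inner_sum[OF assms(2,1)] mult.commute)

lemma frob_inner_diff_right:
  assumes "A \<in> carrier_mat n m" "B \<in> carrier_mat n m" "C \<in> carrier_mat n m"
  shows "frob_inner A (B - C) = frob_inner A B - frob_inner A C"
  using frob_inner_sum[OF assms(1) minus_carrier_mat[OF assms(3), of B]] assms
  by (simp add: frob_inner_sum[OF assms(1,2)] frob_inner_sum[OF assms(1,3)]
      sum_subtractf right_diff_distrib)

lemma frob_inner_transpose: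
  assumes "A \<in> carrier_mat n m" "B \<in> carrier_mat n m"
  shows "frob_inner A\<^sup>T B\<^sup>T = frob_inner A B"
proof -
  have "frob_inner A\<^sup>T B\<^sup>T = (\<Sum>j<m. \<Sum>i<n. A $$ (i,j) * B $$ (i,j))"
    using frob_inner_sum[of "A\<^sup>T" m n "B\<^sup>T"] assms by simp
  also have "\<dots> = (\<Sum>i<n. \<Sum>j<m. A $$ (i,j) * B $$ (i,j))" by (rule sum.swap)
  finally show ?thesis by (simp add: frob_inner_sum[OF assms])
qed

lemma frob_inner_mult_left:
  assumes "P \<in> carrier_mat k n" "A \<in> carrier_mat n m" "B \<in> carrier_mat k m"
  shows "frob_inner (P * A) B = frob_inner A (P\<^sup>T * B)"
  using assms by (simp add: frob_inner_def transpose_mult[OF assms(1,2)]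
      assoc_mult_mat[of "A\<^sup>T" m n "P\<^sup>T" k B m])

lemma frob_inner_orthonormal:
  assumes U: "U \<in> orthonormal_mats n" and V: "V \<in> orthonormal_mats m"
    and A: "A \<in> carrier_mat n m" and B: "B \<in> carrier_mat n m"
  shows "frob_inner (U * A * V\<^sup>T) (U * B * V\<^sup>T) = frob_inner A B"
proof -
  have left: "frob_inner (Q * C) (Q * D) = frob_inner C D"
    if "Q \<in> orthonormal_mats k" "C \<in> carrier_mat k l" "D \<in> carrier_mat k l"
    for Q C D and k l :: nat
    using frob_inner_mult_left[OF orthonormal_matsD(1)[OF that(1)] that(2), of "Q * D"]
      orthonormal_cancel(1)[OF that(1,3)] mult_carrier_mat[OF orthonormal_matsD(1)[OF that(1)] that(3)]
    by simp
  note UD = orthonormal_matsD[OF U] and VD = orthonormal_matsD[OF V]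
  have c: "A * V\<^sup>T \<in> carrier_mat n m" "B * V\<^sup>T \<in> carrier_mat n m" using A B VD by auto
  have "frob_inner (U * A * V\<^sup>T) (U * B * V\<^sup>T) = frob_inner (A * V\<^sup>T) (B * V\<^sup>T)"
    using left[OF U c] assoc_mult_mat[OF UD(1) A VD(2)] assoc_mult_mat[OF UD(1) B VD(2)] by simp
  also have "\<dots> = frob_inner (V * A\<^sup>T) (V * B\<^sup>T)"
    using frob_inner_transpose[OF c] transpose_mult[OF A VD(2)] transpose_mult[OF B VD(2)] by simp
  also have "\<dots> = frob_inner A\<^sup>T B\<^sup>T" using left[OF V, of "A\<^sup>T" n "B\<^sup>T"] A B by simp
  finally show ?thesis using frob_inner_transpose[OF A B] by simp
qed

section \<open>Duality with the spectral unit ball\<close>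

text \<open>
  The unit ball of the spectral norm, in the form \<open>\<parallel>Z\<^sup>T v\<parallel> \<le> 1\<close> for all unit vectors \<open>v\<close>: these
  vectors are the columns of the orthonormal matrices \<open>P\<close>, and \<open>Z\<^sup>T v\<close> is then a row of \<open>P\<^sup>T Z\<close>.
\<close>

definition contraction :: "nat \<Rightarrow> nat \<Rightarrow> real mat \<Rightarrow> bool" where
  "contraction n m Z \<longleftrightarrow> Z \<in> carrier_mat n m \<and>
     (\<forall>P \<in> orthonormal_mats n. \<forall>i<n. (\<Sum>j<m. ((P\<^sup>T * Z) $$ (i,j))\<^sup>2) \<le> 1)"

lemma contractionD:
  assumes "contraction n m Z" "P \<in> orthonormal_mats n" "i < n"
  shows "(\<Sum>j<m. ((P\<^sup>T * Z) $$ (i,j))\<^sup>2) \<le> 1"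
  using assms unfolding contraction_def by blast

text \<open>
  A row of \<open>R H\<close>, where \<open>R = P\<^sup>T Q\<close> is again orthonormal, has squared length
  \<open>\<Sum>\<^sub>k e\<^sub>k R\<^sub>i\<^sub>k\<^sup>2\<close>, which is at most the squared length of a row of \<open>R\<close>.
\<close>

lemma contractionI:
  assumes Q: "Q \<in> orthonormal_mats n" and H: "H \<in> carrier_mat n m"
    and HH: "H * H\<^sup>T = mat_diag n e" and e: "\<And>i. i < n \<Longrightarrow> e i \<le> 1"
  shows "contraction n m (Q * H)"
proof -
  have "(\<Sum>j<m. ((P\<^sup>T * (Q * H)) $$ (i,j))\<^sup>2) \<le> 1"
    if P: "P \<in> orthonormal_mats n" and i: "i < n" for P i
  proof -
    define R where "R = P\<^sup>T * Q"
    have RO: "R \<in> orthonormal_mats n"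
      unfolding R_def by (intro orthonormal_mats_mult orthonormal_mats_transpose P Q)
    note R = orthonormal_matsD[OF RO]
    have RH: "R * H \<in> carrier_mat n m" using R H by simp
    have eq: "P\<^sup>T * (Q * H) = R * H"
      unfolding R_def
      using assoc_mult_mat[OF orthonormal_matsD(2)[OF P] orthonormal_matsD(1)[OF Q] H] by simp
    have "(R * H) * (R * H)\<^sup>T = (R * mat_diag n e) * R\<^sup>T"
      using mult_mult_transpose_orthonormal[OF RO _ H, of "1\<^sub>m m"] R(1) H
      by (simp add: HH orthonormal_mats_def)
    hence "(\<Sum>j<m. ((R * H) $$ (i,j))\<^sup>2) = ((R * mat_diag n e) * R\<^sup>T) $$ (i,i)"
      using mult_transpose_index[OF RH RH i i] by (simp add: power2_eq_square)
    also have "\<dots> = (\<Sum>k<n. e k * (R $$ (i,k))\<^sup>2)"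
      using mult_transpose_index[of "R * mat_diag n e" n n R n i i] R i
      by (simp add: mat_diag_mult_right[OF R(1)] power2_eq_square ac_simps)
    also have "\<dots> \<le> (\<Sum>k<n. (R $$ (i,k))\<^sup>2)"
    proof (rule sum_mono)
      fix k assume "k \<in> {..<n}"
      thus "e k * (R $$ (i,k))\<^sup>2 \<le> (R $$ (i,k))\<^sup>2"
        using mult_right_mono[OF e, of k "(R $$ (i,k))\<^sup>2"] by simp
    qed
    also have "\<dots> = 1" by (rule orthonormal_row_sum[OF RO i])
    finally show ?thesis by (simp add: eq)
  qed
  thus ?thesis using orthonormal_matsD[OF Q] H by (auto simp: contraction_def)
qed

lemma sum_sq_diff_scaled:
  fixes g h :: "nat \<Rightarrow> real"
  shows "(\<Sum>j<m. (g j - c * h j)\<^sup>2)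
    = (\<Sum>j<m. (g j)\<^sup>2) - 2 * c * (\<Sum>j<m. g j * h j) + c\<^sup>2 * (\<Sum>j<m. (h j)\<^sup>2)"
proof -
  have "(g j - c * h j)\<^sup>2 = (g j)\<^sup>2 - 2 * c * (g j * h j) + c\<^sup>2 * (h j)\<^sup>2" for j
    by (simp add: power2_eq_square algebra_simps)
  thus ?thesis by (simp only: sum.distrib sum_subtractf sum_distrib_left)
qed

text \<open>
  Cauchy-Schwarz, derived from the expansion of \<open>\<parallel>g - d h\<parallel>\<^sup>2\<close>; the same expansion settles the
  case of equality later on.
\<close>

lemma sum_mult_le_radius:
  fixes g h :: "nat \<Rightarrow> real"
  assumes g: "(\<Sum>j<m. (g j)\<^sup>2) = d\<^sup>2" and h: "(\<Sum>j<m. (h j)\<^sup>2) \<le> 1" and d: "0 \<le> d"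
  shows "(\<Sum>j<m. g j * h j) \<le> d"
proof (cases "d = 0")
  case True
  hence "\<forall>j\<in>{..<m}. (g j)\<^sup>2 = 0" using g by (subst sum_nonneg_eq_0_iff[symmetric]) auto
  thus ?thesis using True by simp
next
  case False
  have "0 \<le> d\<^sup>2 - 2 * d * (\<Sum>j<m. g j * h j) + d\<^sup>2 * (\<Sum>j<m. (h j)\<^sup>2)"
    using sum_sq_diff_scaled[of g d h m] g sum_nonneg[of "{..<m}" "\<lambda>j. (g j - d * h j)\<^sup>2"] by simp
  also have "\<dots> \<le> d\<^sup>2 - 2 * d * (\<Sum>j<m. g j * h j) + d\<^sup>2"
    using h by (simp add: mult_left_le)
  finally have "d * (\<Sum>j<m. g j * h j) \<le> d * d" by (simp add: power2_eq_square)
  thus ?thesis using False d by simp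
qed

text \<open>
  With \<open>W = P G\<close>, the pairing with \<open>Z\<close> is the sum over \<open>i\<close> of the inner products of the rows of
  \<open>G\<close>, of length \<open>d\<^sub>i\<close>, with the rows of \<open>P\<^sup>T Z\<close>, of length at most 1.
\<close>

lemma frob_inner_le_nuclear_norm:
  assumes Z: "contraction n m Z" and W: "W \<in> carrier_mat n m"
  shows "frob_inner Z W \<le> nuclear_norm W"
proof -
  obtain P G d where d: "P \<in> orthonormal_mats n" "G \<in> carrier_mat n m" "W = P * G"
    "G * G\<^sup>T = mat_diag n (\<lambda>i. (d i)\<^sup>2)" "\<forall>i. 0 \<le> d i"
    by (rule orthogonal_rows_decomposition[OF W])
  note P = orthonormal_matsD[OF d(1)]
  have Zc: "Z \<in> carrier_mat n m" using Z by (simp add: contraction_def)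
  have PZ: "P\<^sup>T * Z \<in> carrier_mat n m" using P Zc by simp
  have "frob_inner Z W = frob_inner G (P\<^sup>T * Z)"
    using frob_inner_commute[OF Zc W] frob_inner_mult_left[OF P(1) d(2) Zc] d(3) by simp
  also have "\<dots> \<le> (\<Sum>i<n. d i)"
    unfolding frob_inner_sum[OF d(2) PZ]
  proof (rule sum_mono)
    fix i assume "i \<in> {..<n}"
    hence i: "i < n" by simp
    show "(\<Sum>j<m. G $$ (i,j) * (P\<^sup>T * Z) $$ (i,j)) \<le> d i"
      by (rule sum_mult_le_radius[OF sum_sq_rows[OF d(2,4) i] contractionD[OF Z d(1) i] d(5)[rule_format]])
  qed
  also have "\<dots> = nuclear_norm W"
    unfolding d(3) by (rule nuclear_norm_eq_sum[OF d(1,2,4), symmetric]) (simp add: d(5))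
  finally show ?thesis .
qed

text \<open>
  The maximizer is \<open>P\<close> times the matrix of normalized rows of \<open>G\<close>.
\<close>

lemma nuclear_norm_attained:
  assumes W: "W \<in> carrier_mat n m"
  obtains Z where "contraction n m Z" "frob_inner Z W = nuclear_norm W"
proof -
  obtain P G d where d: "P \<in> orthonormal_mats n" "G \<in> carrier_mat n m" "W = P * G"
    "G * G\<^sup>T = mat_diag n (\<lambda>i. (d i)\<^sup>2)" "\<forall>i. 0 \<le> d i"
    by (rule orthogonal_rows_decomposition[OF W])
  note P = orthonormal_matsD[OF d(1)]
  (* A zero row of G stays zero, since division by zero gives zero. *)
  define H where "H = mat n m (\<lambda>(i,j). G $$ (i,j) / d i)"
  have H: "H \<in> carrier_mat n m" by (simp add: H_def)
  have GG: "(\<Sum>l<m. G $$ (i,l) * G $$ (k,l)) = (if i = k then (d i)\<^sup>2 else 0)"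
    if "i < n" "k < n" for i k
    unfolding mult_transpose_index[OF d(2,2) that, symmetric] d(4) using that by simp
  have "H * H\<^sup>T = mat_diag n (\<lambda>i. if d i = 0 then 0 else 1)"
  proof (rule eq_matI)
    fix i k assume "i < dim_row (mat_diag n (\<lambda>i. if d i = 0 then 0 else (1::real)))"
      "k < dim_col (mat_diag n (\<lambda>i. if d i = 0 then 0 else (1::real)))"
    hence ik: "i < n" "k < n" by simp_all
    have "(H * H\<^sup>T) $$ (i,k) = (\<Sum>l<m. G $$ (i,l) * G $$ (k,l)) / (d i * d k)"
      using mult_transpose_index[OF H H ik] ik by (simp add: H_def sum_divide_distrib)
    thus "(H * H\<^sup>T) $$ (i,k) = mat_diag n (\<lambda>i. if d i = 0 then 0 else 1) $$ (i,k)"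
      using ik by (simp add: GG mat_diag_def power2_eq_square)
  qed (auto simp: H_def mat_diag_def)
  hence "contraction n m (P * H)" by (rule contractionI[OF d(1) H]) auto
  moreover have "frob_inner (P * H) W = nuclear_norm W"
  proof -
    have "frob_inner (P * H) W = frob_inner H G"
      using frob_inner_mult_left[OF P(1) H W] orthonormal_cancel(1)[OF d(1,2)] d(3) by simp
    also have "\<dots> = (\<Sum>i<n. (\<Sum>j<m. G $$ (i,j) * G $$ (i,j)) / d i)"
      unfolding frob_inner_sum[OF H d(2)] by (simp add: H_def sum_divide_distrib)
    also have "\<dots> = (\<Sum>i<n. d i)" by (simp add: GG power2_eq_square)
    also have "\<dots> = nuclear_norm W"
    unfolding d(3) by (rule nuclear_norm_eq_sum[OF d(1,2,4), symmetric]) (simp add: d(5))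
    finally show ?thesis .
  qed
  ultimately show ?thesis using that by blast
qed

text \<open>
  The supremum that defines the conjugate is attained at the zero matrix.
\<close>

lemma conjugate_nuclear_norm_contraction:
  assumes Z: "contraction n m Z"
  shows "fenchel_conjugate n m (\<lambda>Z. ereal (nuclear_norm Z)) Z = 0"
  unfolding fenchel_conjugate_def
proof (rule antisym)
  show "(SUP X\<in>carrier_mat n m. ereal (frob_inner Z X) - ereal (nuclear_norm X)) \<le> 0"
    using frob_inner_le_nuclear_norm[OF Z] by (intro SUP_least) simp
  have "ereal (frob_inner Z (0\<^sub>m n m)) - ereal (nuclear_norm (0\<^sub>m n m)) = 0"
    using Z frob_inner_sum[of Z n m "0\<^sub>m n m"] by (simp add: nuclear_norm_zero contraction_def)
  thus "0 \<le> (SUP X\<in>carrier_mat n m. ereal (frob_inner Z X) - ereal (nuclear_norm X))"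
    by (intro SUP_upper2[of "0\<^sub>m n m"]) auto
qed

text \<open>
  This is the equality case of Fenchel's inequality. For the inclusion from left to right the subgradient inequality is
  tested at a point of the unit ball that attains the nuclear norm of \<open>W\<close>; for the converse the
  supremum in the conjugate is bounded below by its value at \<open>W\<close>.
\<close>

lemma subdifferential_conjugate_nuclear_norm:
  assumes Y: "contraction n m Y"
  shows "subdifferential n m (fenchel_conjugate n m (\<lambda>Z. ereal (nuclear_norm Z))) Y
    = {W \<in> carrier_mat n m. nuclear_norm W \<le> frob_inner W Y}" (is "?L = ?R")
proof
  let ?c = "fenchel_conjugate n m (\<lambda>Z. ereal (nuclear_norm Z))"
  note c0 = conjugate_nuclear_norm_contraction
  have Yc: "Y \<in> carrier_mat n m" using Y by (simp add: contraction_def)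
  show "?L \<subseteq> ?R"
  proof
    fix W assume W: "W \<in> ?L"
    hence Wc: "W \<in> carrier_mat n m" by (simp add: subdifferential_def)
    obtain Z where Z: "contraction n m Z" "frob_inner Z W = nuclear_norm W"
      using nuclear_norm_attained[OF Wc] .
    have Zc: "Z \<in> carrier_mat n m" using Z by (simp add: contraction_def)
    have "?c Z \<ge> ?c Y + ereal (frob_inner W (Z - Y))"
      using W Zc by (simp add: subdifferential_def)
    thus "W \<in> ?R"
      using Z Wc frob_inner_commute[OF Zc Wc]
      by (simp add: c0[OF Z(1)] c0[OF Y] frob_inner_diff_right[OF Wc Zc Yc])
  qed
  show "?R \<subseteq> ?L"
  proof
    fix W assume W: "W \<in> ?R"
    hence Wc: "W \<in> carrier_mat n m" by simp
    have "?c Z \<ge> ?c Y + ereal (frob_inner W (Z - Y))" if Z: "Z \<in> carrier_mat n m" for Z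
    proof -
      have "?c Y + ereal (frob_inner W (Z - Y)) \<le> ereal (frob_inner Z W) - ereal (nuclear_norm W)"
        using W frob_inner_commute[OF Z Wc]
        by (simp add: c0[OF Y] frob_inner_diff_right[OF Wc Z Yc])
      also have "\<dots> \<le> ?c Z" unfolding fenchel_conjugate_def by (rule SUP_upper[OF Wc])
      finally show ?thesis .
    qed
    thus "W \<in> ?L" using Wc by (simp add: subdifferential_def c0[OF Y])
  qed
qed

section \<open>The subdifferential of the conjugate in singular coordinates\<close>

definition corner :: "nat \<Rightarrow> nat \<Rightarrow> nat \<Rightarrow> real mat \<Rightarrow> real mat" where
  "corner n m p S =
     four_block_mat S (0\<^sub>m p (m - p)) (0\<^sub>m (n - p) p) (0\<^sub>m (n - p) (m - p))"

lemma corner_carrier: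
  assumes "S \<in> carrier_mat p p" "p \<le> n" "p \<le> m"
  shows "corner n m p S \<in> carrier_mat n m"
  using assms by (auto simp: corner_def)

lemma index_corner:
  assumes "S \<in> carrier_mat p p" "p \<le> n" "p \<le> m" "i < n" "j < m"
  shows "corner n m p S $$ (i,j) = (if i < p \<and> j < p then S $$ (i,j) else 0)"
  using assms by (auto simp: corner_def)

definition rect_diag :: "nat \<Rightarrow> nat \<Rightarrow> (nat \<Rightarrow> real) \<Rightarrow> real mat" where
  "rect_diag n m y = mat n m (\<lambda>(i,j). if i = j then y i else 0)"

lemma rect_diag_carrier [simp]: "rect_diag n m y \<in> carrier_mat n m"
  by (simp add: rect_diag_def)

lemma index_rect_diag [simp]:
  "i < n \<Longrightarrow> j < m \<Longrightarrow> rect_diag n m y $$ (i,j) = (if i = j then y i else 0)"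
  by (simp add: rect_diag_def)

lemma rect_diag_gram:
  assumes "n \<le> m"
  shows "rect_diag n m y * (rect_diag n m y)\<^sup>T = mat_diag n (\<lambda>i. (y i)\<^sup>2)"
proof (rule eq_matI)
  fix i j assume "i < dim_row (mat_diag n (\<lambda>i. (y i)\<^sup>2))" "j < dim_col (mat_diag n (\<lambda>i. (y i)\<^sup>2))"
  hence ij: "i < n" "j < n" by auto
  have "(rect_diag n m y * (rect_diag n m y)\<^sup>T) $$ (i,j)
    = (\<Sum>l<m. (if i = l then y i else 0) * (if j = l then y j else 0))"
    unfolding mult_transpose_index[OF rect_diag_carrier rect_diag_carrier ij]
    by (intro sum.cong) (use ij in auto)
  also have "\<dots> = (\<Sum>l<m. if i = l then (if i = j then (y i)\<^sup>2 else 0) else 0)"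
    by (intro sum.cong) (auto simp: power2_eq_square)
  also have "\<dots> = (if i = j then (y j)\<^sup>2 else 0)" using ij assms by simp
  finally show "(rect_diag n m y * (rect_diag n m y)\<^sup>T) $$ (i,j) = mat_diag n (\<lambda>i. (y i)\<^sup>2) $$ (i,j)"
    using ij by simp
qed (auto simp: rect_diag_def)

lemma sum_lessThan_restrict:
  fixes f :: "nat \<Rightarrow> 'a::comm_monoid_add"
  assumes "p \<le> n"
  shows "(\<Sum>i<n. if i < p then f i else 0) = (\<Sum>i<p. f i)"
proof -
  have "{..<n} \<inter> {i. i < p} = {..<p}" using assms by auto
  thus ?thesis by (simp add: sum.If_cases)
qed

text \<open>
  The eigenvalues of a positive semidefinite matrix are its singular values, and padding with zeros
  adds only zeros. With \<open>S = Q \<Lambda> Q\<^sup>T\<close>, the padded matrix is \<open>diag(Q, 1)\<close> times the padding of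
  \<open>\<Lambda> Q\<^sup>T\<close>, whose rows are orthogonal.
\<close>

lemma nuclear_norm_corner_psd:
  assumes S: "S \<in> psd_mats p" and pn: "p \<le> n" and pm: "p \<le> m"
  shows "nuclear_norm (corner n m p S) = (\<Sum>i<p. S $$ (i,i))"
proof -
  have Sc: "S \<in> carrier_mat p p" "S\<^sup>T = S" using S by (auto simp: psd_mats_def sym_mats_def)
  obtain Q l where QO: "Q \<in> orthonormal_mats p" and Sl: "S = Q * mat_diag p l * Q\<^sup>T"
    using real_spectral_theorem[OF Sc] by blast
  note Q = orthonormal_matsD[OF QO]
  have QQ: "(\<Sum>k<p. Q $$ (k,i) * Q $$ (k,j)) = (if i = j then 1 else 0)" if "i < p" "j < p" for i j
    using mult_transpose_index[OF Q(2,2) that] that Q by simp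
  have LQ: "mat_diag p l * Q\<^sup>T \<in> carrier_mat p p" by (rule mult_carrier_mat[OF mat_diag_dim Q(2)])
  have QL: "Q * mat_diag p l \<in> carrier_mat p p" by (rule mult_carrier_mat[OF Q(1) mat_diag_dim])
  have l: "0 \<le> l i" if i: "i < p" for i
  proof -
    have SQ: "S * Q = Q * mat_diag p l"
      unfolding Sl assoc_mult_mat[OF QL Q(2) Q(1)] Q(3) using QL by simp
    have "S *\<^sub>v col Q i = col (Q * mat_diag p l) i"
      unfolding SQ[symmetric] by (rule col_mult2[OF Sc(1) Q(1) i, symmetric])
    also have "\<dots> = l i \<cdot>\<^sub>v col Q i"
      unfolding mat_diag_mult_right[OF Q(1)] using i Q by (intro eq_vecI) auto
    finally have "col Q i \<bullet> (S *\<^sub>v col Q i) = l i"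
      using QQ[OF i i] i Q
      by (simp add: scalar_prod_def atLeast0LessThan mult.left_commute[of _ "l i"]
          sum_distrib_left[symmetric])
    moreover have "col Q i \<in> carrier_vec p" using Q i by auto
    ultimately show ?thesis using S unfolding psd_mats_def by force
  qed
  let ?K = "four_block_mat Q (0\<^sub>m p (n - p)) (0\<^sub>m (n - p) p) (1\<^sub>m (n - p))"
  let ?G = "corner n m p (mat_diag p l * Q\<^sup>T)"
  let ?d = "\<lambda>i. if i < p then l i else 0"
  have "?K \<in> orthonormal_mats (p + (n - p))"
    by (rule orthonormal_block[OF QO]) (simp add: orthonormal_mats_def)
  hence KO: "?K \<in> orthonormal_mats n" using pn by simp
  have G: "?G \<in> carrier_mat n m" by (rule corner_carrier[OF LQ pn pm])
  have "?K * ?G = corner n m p (Q * (mat_diag p l * Q\<^sup>T))"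
    unfolding corner_def using Q LQ mult_carrier_mat[OF Q(1) LQ]
    by (subst mult_four_block_mat[of _ p p _ "n-p" _ "n-p" _ _ p _ "m-p"]) auto
  also have "Q * (mat_diag p l * Q\<^sup>T) = S"
    unfolding Sl by (rule assoc_mult_mat[OF Q(1) mat_diag_dim Q(2), symmetric])
  finally have KG: "?K * ?G = corner n m p S" .
  have Gi: "?G $$ (i,j) = (if i < p \<and> j < p then l i * Q $$ (j,i) else 0)" if "i < n" "j < m" for i j
  proof -
    have "(mat_diag p l * Q\<^sup>T) $$ (i,j) = l i * Q $$ (j,i)" if "i < p" "j < p"
      unfolding mat_diag_mult_left[OF Q(2)] using Q(1) that by simp
    thus ?thesis unfolding index_corner[OF LQ pn pm that] by simp
  qed
  have "?G * ?G\<^sup>T = mat_diag n (\<lambda>i. (?d i)\<^sup>2)"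
  proof (rule eq_matI)
    fix i j assume "i < dim_row (mat_diag n (\<lambda>i. (?d i)\<^sup>2))" "j < dim_col (mat_diag n (\<lambda>i. (?d i)\<^sup>2))"
    hence ij: "i < n" "j < n" by auto
    have "(?G * ?G\<^sup>T) $$ (i,j) = (\<Sum>k<m. if k < p then
        (if i < p \<and> j < p then l i * l j * (Q $$ (k,i) * Q $$ (k,j)) else 0) else 0)"
      unfolding mult_transpose_index[OF G G ij] by (intro sum.cong) (use ij in \<open>auto simp: Gi\<close>)
    also have "\<dots> = (if i < p \<and> j < p then l i * l j * (\<Sum>k<p. Q $$ (k,i) * Q $$ (k,j)) else 0)"
      unfolding sum_lessThan_restrict[OF pm]
    proof (cases "i < p \<and> j < p")
      case False
      thus "(\<Sum>k<p. if i < p \<and> j < p then l i * l j * (Q $$ (k,i) * Q $$ (k,j)) else 0)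
        = (if i < p \<and> j < p then l i * l j * (\<Sum>k<p. Q $$ (k,i) * Q $$ (k,j)) else 0)"
        by (simp only: if_False sum.neutral_const)
    qed (simp add: sum_distrib_left)
    finally show "(?G * ?G\<^sup>T) $$ (i,j) = mat_diag n (\<lambda>i. (?d i)\<^sup>2) $$ (i,j)"
      using ij QQ[of i j] by (auto simp: power2_eq_square)
  qed (use G in auto)
  from nuclear_norm_eq_sum[OF KO G this] have "nuclear_norm (corner n m p S) = (\<Sum>i<n. ?d i)"
    using l unfolding KG by simp
  also have "\<dots> = (\<Sum>k<p. l k)" by (rule sum_lessThan_restrict[OF pn])
  also have "\<dots> = (\<Sum>k<p. \<Sum>i<p. l k * (Q $$ (i,k) * Q $$ (i,k)))"
    by (simp add: sum_distrib_left[symmetric] QQ)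
  also have "\<dots> = (\<Sum>i<p. \<Sum>k<p. l k * (Q $$ (i,k) * Q $$ (i,k)))" by (rule sum.swap)
  also have "\<dots> = (\<Sum>i<p. S $$ (i,i))"
  proof (rule sum.cong[OF refl])
    fix i assume "i \<in> {..<p}"
    hence i: "i < p" by simp
    have "S $$ (i,i) = (\<Sum>k<p. (Q * mat_diag p l) $$ (i,k) * Q $$ (i,k))"
      by (subst Sl) (rule mult_transpose_index[OF QL Q(1) i i])
    also have "\<dots> = (\<Sum>k<p. l k * (Q $$ (i,k) * Q $$ (i,k)))"
      unfolding mat_diag_mult_right[OF Q(1)] by (intro sum.cong) (use i in auto)
    finally show "(\<Sum>k<p. l k * (Q $$ (i,k) * Q $$ (i,k))) = S $$ (i,i)" ..
  qed
  finally show ?thesis .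
qed

text \<open>
  The quadratic form is \<open>\<Sum>\<^sub>i d\<^sub>i (v \<bullet> a\<^sub>i)\<^sup>2\<close>.
\<close>

lemma rank_one_sum_psd:
  assumes d: "\<And>i. i < n \<Longrightarrow> 0 \<le> d i"
  shows "mat p p (\<lambda>(k,l). \<Sum>i<n. d i * (a k i * a l i)) \<in> psd_mats p" (is "?S \<in> _")
proof -
  have "0 \<le> v \<bullet> (?S *\<^sub>v v)" if v: "v \<in> carrier_vec p" for v
  proof -
    have "v \<bullet> (?S *\<^sub>v v) = (\<Sum>k<p. \<Sum>l<p. \<Sum>i<n. d i * ((v $ k * a k i) * (v $ l * a l i)))"
      using v by (simp add: scalar_prod_def atLeast0LessThan sum_distrib_left sum_distrib_right ac_simps)
    also have "\<dots> = (\<Sum>k<p. \<Sum>i<n. \<Sum>l<p. d i * ((v $ k * a k i) * (v $ l * a l i)))"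
      by (intro sum.cong refl) (rule sum.swap)
    also have "\<dots> = (\<Sum>i<n. \<Sum>k<p. \<Sum>l<p. d i * ((v $ k * a k i) * (v $ l * a l i)))"
      by (rule sum.swap)
    also have "\<dots> = (\<Sum>i<n. d i * (\<Sum>k<p. v $ k * a k i)\<^sup>2)"
      unfolding power2_eq_square sum_product by (simp only: sum_distrib_left)
    also have "\<dots> \<ge> 0" using d by (intro sum_nonneg) auto
    finally show ?thesis .
  qed
  moreover have "?S\<^sup>T = ?S" by (rule eq_matI) (auto simp: ac_simps)
  ultimately show ?thesis by (auto simp: psd_mats_def sym_mats_def)
qed

text \<open>
  Let \<open>D\<close> be the diagonal matrix and write \<open>M = P G\<close> with orthogonal rows of lengths \<open>d\<^sub>i\<close>. The
  inequality forces equality in Cauchy-Schwarz for every row, so \<open>G = diag(d) H\<close> for \<open>H = P\<^sup>T D\<close>,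
  and the rows of \<open>H\<close> with \<open>d\<^sub>i > 0\<close> have length 1. Such a row is column \<open>i\<close> of \<open>P\<close> with its entries
  scaled by \<open>y\<close>; since \<open>y\<^sub>j < 1\<close> for \<open>j \<ge> p\<close>, the length is preserved only if those entries
  vanish. Therefore \<open>M = P diag(d) P\<^sup>T D\<close> is supported on the leading \<open>p \<times> p\<close> block, where \<open>D\<close> is
  the identity.
\<close>

lemma nuclear_norm_le_frob_inner_rect_diag:
  assumes pn: "p \<le> n" and nm: "n \<le> m"
    and y1: "\<And>i. i < p \<Longrightarrow> y i = 1"
    and y2: "\<And>i. p \<le> i \<Longrightarrow> i < n \<Longrightarrow> 0 \<le> y i \<and> y i < 1"
  shows "{M \<in> carrier_mat n m. nuclear_norm M \<le> frob_inner M (rect_diag n m y)}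
    = corner n m p ` psd_mats p"
proof (intro equalityI subsetI)
  let ?D = "rect_diag n m y"
  have pm: "p \<le> m" using pn nm by simp
  fix M assume "M \<in> corner n m p ` psd_mats p"
  then obtain S where S: "S \<in> psd_mats p" and M: "M = corner n m p S" by blast
  have Sc: "S \<in> carrier_mat p p" using S by (simp add: psd_mats_def sym_mats_def)
  note C = corner_carrier[OF Sc pn pm]
  have "frob_inner M ?D = (\<Sum>i<n. \<Sum>j<m. if i = j then (if i < p then S $$ (i,i) else 0) else 0)"
    unfolding M frob_inner_sum[OF C rect_diag_carrier]
    by (intro sum.cong) (auto simp: index_corner[OF Sc pn pm] y1)
  also have "\<dots> = (\<Sum>i<n. if i < p then S $$ (i,i) else 0)" using nm by (intro sum.cong) auto
  also have "\<dots> = nuclear_norm M"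
    unfolding M nuclear_norm_corner_psd[OF S pn pm] by (rule sum_lessThan_restrict[OF pn])
  finally show "M \<in> {M \<in> carrier_mat n m. nuclear_norm M \<le> frob_inner M ?D}"
    using C M by simp
next
  let ?D = "rect_diag n m y"
  have pm: "p \<le> m" using pn nm by simp
  have y01: "0 \<le> y i" "y i \<le> 1" if "i < n" for i
    using that y1[of i] y2[of i] by (cases "i < p"; force)+
  fix M assume "M \<in> {M \<in> carrier_mat n m. nuclear_norm M \<le> frob_inner M ?D}"
  hence Mc: "M \<in> carrier_mat n m" and le: "nuclear_norm M \<le> frob_inner M ?D" by auto
  obtain P G d where d: "P \<in> orthonormal_mats n" "G \<in> carrier_mat n m" "M = P * G"
    "G * G\<^sup>T = mat_diag n (\<lambda>i. (d i)\<^sup>2)" "\<forall>i. 0 \<le> d i"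
    by (rule orthogonal_rows_decomposition[OF Mc])
  note P = orthonormal_matsD[OF d(1)]
  define H where "H = P\<^sup>T * ?D"
  have H: "H \<in> carrier_mat n m" unfolding H_def by (rule mult_carrier_mat[OF P(2) rect_diag_carrier])
  have Hij: "H $$ (i,j) = (if j < n then P $$ (j,i) * y j else 0)" if "i < n" "j < m" for i j
  proof -
    have "H $$ (i,j) = (\<Sum>k<n. P $$ (k,i) * (if k = j then y k else 0))"
      using that P(1) by (simp add: H_def scalar_prod_def atLeast0LessThan rect_diag_def)
    also have "\<dots> = (\<Sum>k<n. if k = j then P $$ (j,i) * y j else 0)" by (intro sum.cong) auto
    finally show ?thesis by simp
  qed
  have "contraction n m (1\<^sub>m n * ?D)"
    by (rule contractionI[OF _ rect_diag_carrier rect_diag_gram[OF nm]])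
      (auto simp: orthonormal_mats_def power_le_one y01)
  hence "contraction n m ?D" by (simp add: left_mult_one_mat[OF rect_diag_carrier])
  hence h: "(\<Sum>j<m. (H $$ (i,j))\<^sup>2) \<le> 1" if "i < n" for i
    unfolding H_def using that by (intro contractionD[OF _ d(1)])
  note g = sum_sq_rows[OF d(2,4)]
  have t: "(\<Sum>j<m. G $$ (i,j) * H $$ (i,j)) \<le> d i" if "i < n" for i
    by (rule sum_mult_le_radius[OF g[OF that] h[OF that]]) (simp add: d(5))
  have "nuclear_norm M = (\<Sum>i<n. d i)"
    unfolding d(3) by (rule nuclear_norm_eq_sum[OF d(1,2,4)]) (simp add: d(5))
  moreover have "frob_inner M ?D = (\<Sum>i<n. \<Sum>j<m. G $$ (i,j) * H $$ (i,j))"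
    unfolding d(3) frob_inner_mult_left[OF P(1) d(2) rect_diag_carrier] H_def[symmetric]
    by (rule frob_inner_sum[OF d(2) H])
  (* Every row defect d i - <G_i, H_i> is nonnegative, and their sum is not positive. *)
  ultimately have "(\<Sum>i<n. d i - (\<Sum>j<m. G $$ (i,j) * H $$ (i,j))) \<le> 0"
    using le by (simp add: sum_subtractf)
  moreover have "(\<Sum>i<n. d i - (\<Sum>j<m. G $$ (i,j) * H $$ (i,j))) \<ge> 0"
    using t by (intro sum_nonneg) auto
  ultimately have "(\<Sum>i<n. d i - (\<Sum>j<m. G $$ (i,j) * H $$ (i,j))) = 0" by simp
  hence "\<forall>i\<in>{..<n}. d i - (\<Sum>j<m. G $$ (i,j) * H $$ (i,j)) = 0"
    using t by (subst (asm) sum_nonneg_eq_0_iff) auto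
  hence teq: "(\<Sum>j<m. G $$ (i,j) * H $$ (i,j)) = d i" if "i < n" for i using that by auto
  have diff: "(\<Sum>j<m. (G $$ (i,j) - d i * H $$ (i,j))\<^sup>2) = (d i)\<^sup>2 * ((\<Sum>j<m. (H $$ (i,j))\<^sup>2) - 1)"
    if "i < n" for i
    unfolding sum_sq_diff_scaled g[OF that] teq[OF that] by (simp add: power2_eq_square algebra_simps)
  have GH: "G $$ (i,j) = d i * H $$ (i,j)" if "i < n" "j < m" for i j
  proof -
    have "(d i)\<^sup>2 * ((\<Sum>j<m. (H $$ (i,j))\<^sup>2) - 1) \<le> 0"
      using h[OF that(1)] by (intro mult_nonneg_nonpos) auto
    hence "(\<Sum>j<m. (G $$ (i,j) - d i * H $$ (i,j))\<^sup>2) = 0"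
      using diff[OF that(1)] sum_nonneg[of "{..<m}" "\<lambda>j. (G $$ (i,j) - d i * H $$ (i,j))\<^sup>2"] by simp
    hence "\<forall>j\<in>{..<m}. (G $$ (i,j) - d i * H $$ (i,j))\<^sup>2 = 0"
      by (subst (asm) sum_nonneg_eq_0_iff) auto
    thus ?thesis using that by simp
  qed
  have zero: "d i * P $$ (j,i) = 0" if i: "i < n" and j: "p \<le> j" "j < n" for i j
  proof (cases "d i = 0")
    case False
    have "0 \<le> (d i)\<^sup>2 * ((\<Sum>j<m. (H $$ (i,j))\<^sup>2) - 1)"
      unfolding diff[OF i, symmetric] by (intro sum_nonneg) simp
    hence h1: "1 \<le> (\<Sum>j<m. (H $$ (i,j))\<^sup>2)" using False by (simp add: zero_le_mult_iff)
    have "(\<Sum>j<m. (H $$ (i,j))\<^sup>2) = (\<Sum>j<m. if j < n then (P $$ (j,i))\<^sup>2 * (y j)\<^sup>2 else 0)"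
      by (intro sum.cong) (auto simp: Hij[OF i] power_mult_distrib)
    also have "\<dots> = (\<Sum>j<n. (P $$ (j,i))\<^sup>2 * (y j)\<^sup>2)" by (rule sum_lessThan_restrict[OF nm])
    finally have h2: "(\<Sum>j<m. (H $$ (i,j))\<^sup>2) = (\<Sum>j<n. (P $$ (j,i))\<^sup>2 * (y j)\<^sup>2)" .
    have "(\<Sum>j<n. (P $$ (j,i))\<^sup>2) = 1"
      using orthonormal_row_sum[OF orthonormal_mats_transpose[OF d(1)] i] P(1) i by simp
    hence "(\<Sum>j<n. (P $$ (j,i))\<^sup>2 * (1 - (y j)\<^sup>2)) \<le> 0"
      using h1 unfolding h2 by (simp add: right_diff_distrib sum_subtractf)
    moreover have nn: "0 \<le> (P $$ (j,i))\<^sup>2 * (1 - (y j)\<^sup>2)" if "j < n" for j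
      using y01[OF that] by (intro mult_nonneg_nonneg) (auto simp: power_le_one)
    ultimately have "(\<Sum>j<n. (P $$ (j,i))\<^sup>2 * (1 - (y j)\<^sup>2)) = 0"
      using sum_nonneg[of "{..<n}" "\<lambda>j. (P $$ (j,i))\<^sup>2 * (1 - (y j)\<^sup>2)"] by force
    hence "\<forall>j\<in>{..<n}. (P $$ (j,i))\<^sup>2 * (1 - (y j)\<^sup>2) = 0"
      using nn by (subst (asm) sum_nonneg_eq_0_iff) auto
    hence "(P $$ (j,i))\<^sup>2 * (1 - (y j)\<^sup>2) = 0" using j by simp
    moreover have "(y j)\<^sup>2 < 1" using y2[OF j] by (simp add: power_less_one_iff)
    ultimately show ?thesis by simp
  qed simp
  define S where "S = mat p p (\<lambda>(k,l). \<Sum>i<n. d i * (P $$ (k,i) * P $$ (l,i)))"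
  have S: "S \<in> psd_mats p" unfolding S_def by (rule rank_one_sum_psd) (simp add: d(5))
  have Sc: "S \<in> carrier_mat p p" by (simp add: S_def)
  have "M = corner n m p S"
  proof (rule eq_matI)
    fix k l assume "k < dim_row (corner n m p S)" "l < dim_col (corner n m p S)"
    hence kl: "k < n" "l < m" using corner_carrier[OF Sc pn pm] by auto
    have "M $$ (k,l) = (\<Sum>i<n. P $$ (k,i) * G $$ (i,l))"
      unfolding d(3) using kl P(1) d(2) by (simp add: scalar_prod_def atLeast0LessThan)
    also have "\<dots> = (\<Sum>i<n. if l < n then d i * P $$ (k,i) * (P $$ (l,i) * y l) else 0)"
      by (intro sum.cong) (use kl in \<open>auto simp: GH Hij\<close>)
    also have "\<dots> = (if k < p \<and> l < p then S $$ (k,l) else 0)"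
    proof (cases "k < p \<and> l < p")
      case True
      thus ?thesis using pn y1[of l] by (simp add: S_def mult.assoc)
    next
      case False
      have "d i * P $$ (k,i) * (P $$ (l,i) * y l) = 0" if "i < n" "l < n" for i
        using False zero[OF that(1), of k] zero[OF that(1), of l] kl that(2) by (cases "k < p") auto
      thus ?thesis using False by (intro sum.neutral[THEN trans]) auto
    qed
    finally show "M $$ (k,l) = corner n m p S $$ (k,l)"
      unfolding index_corner[OF Sc pn pm kl] .
  qed (use corner_carrier[OF Sc pn pm] Mc in auto)
  thus "M \<in> corner n m p ` psd_mats p" using S by blast
qed

section \<open>Positive semidefinite block matrices\<close>

lemma psd_matsD:
  assumes "C \<in> psd_mats n"
  shows "C \<in> carrier_mat n n" "C\<^sup>T = C" "v \<in> carrier_vec n \<Longrightarrow> 0 \<le> v \<bullet> (C *\<^sub>v v)"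
  using assms by (auto simp: psd_mats_def sym_mats_def)

lemma psd_matsI:
  assumes "C \<in> carrier_mat n n" "C\<^sup>T = C"
    and "\<And>v. v \<in> carrier_vec n \<Longrightarrow> 0 \<le> v \<bullet> (C *\<^sub>v v)"
  shows "C \<in> psd_mats n"
  using assms by (auto simp: psd_mats_def sym_mats_def)

lemma psd_smult:
  assumes "C \<in> psd_mats n" "0 \<le> t"
  shows "t \<cdot>\<^sub>m C \<in> psd_mats n"
proof (rule psd_matsI)
  note C = psd_matsD[OF assms(1)]
  show "t \<cdot>\<^sub>m C \<in> carrier_mat n n" using C(1) by simp
  show "(t \<cdot>\<^sub>m C)\<^sup>T = t \<cdot>\<^sub>m C" using arg_cong[OF C(2), of "\<lambda>M. t \<cdot>\<^sub>m M"] by (metis smult_mat_def map_mat_transpose)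
  fix v :: "real vec" assume v: "v \<in> carrier_vec n"
  have "(t \<cdot>\<^sub>m C) *\<^sub>v v = t \<cdot>\<^sub>v (C *\<^sub>v v)"
    using C(1) v by (intro eq_vecI) auto
  thus "0 \<le> v \<bullet> ((t \<cdot>\<^sub>m C) *\<^sub>v v)" using C(1) C(3)[OF v] v assms(2) by simp
qed

lemma sym_mats_index:
  assumes "S \<in> sym_mats n" "i < n" "j < n"
  shows "S $$ (i,j) = S $$ (j,i)"
proof -
  have S: "S \<in> carrier_mat n n" "S\<^sup>T = S" using assms(1) by (auto simp: sym_mats_def)
  have "S $$ (i,j) = S\<^sup>T $$ (j,i)" using S(1) assms(2,3) by simp
  thus ?thesis by (simp only: S(2))
qed

lemma symmetric_block_split:
  fixes S :: "real mat"
  assumes S: "S \<in> sym_mats (r + q)"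
  obtains A D C where "S = four_block_mat A D D\<^sup>T C" "A \<in> sym_mats r" "D \<in> carrier_mat r q"
    "C \<in> sym_mats q"
proof
  let ?A = "mat r r (\<lambda>(i,j). S $$ (i,j))" and ?D = "mat r q (\<lambda>(i,j). S $$ (i,r + j))"
    and ?C = "mat q q (\<lambda>(i,j). S $$ (r + i,r + j))"
  have Sc: "S \<in> carrier_mat (r + q) (r + q)" and ST: "S\<^sup>T = S" using S by (auto simp: sym_mats_def)
  note sym = sym_mats_index[OF S]
  show "S = four_block_mat ?A ?D ?D\<^sup>T ?C"
    by (rule eq_matI) (use Sc sym in auto)
  show "?A \<in> sym_mats r" unfolding sym_mats_def by (auto intro!: eq_matI sym)
  show "?C \<in> sym_mats q" unfolding sym_mats_def by (auto intro!: eq_matI sym)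
  show "?D \<in> carrier_mat r q" by simp
qed

lemma block_sym_mats:
  fixes A C D :: "real mat"
  assumes "A \<in> sym_mats r" "D \<in> carrier_mat r q" "C \<in> sym_mats q"
  shows "four_block_mat A D D\<^sup>T C \<in> sym_mats (r + q)"
proof -
  have "(four_block_mat A D D\<^sup>T C)\<^sup>T = four_block_mat A\<^sup>T D\<^sup>T\<^sup>T D\<^sup>T C\<^sup>T"
    using assms by (intro transpose_four_block_mat) (auto simp: sym_mats_def)
  thus ?thesis using assms by (auto simp: sym_mats_def)
qed

lemma scalar_prod_symmetric:
  fixes A :: "real mat"
  assumes "A \<in> carrier_mat n n" "A\<^sup>T = A" "v \<in> carrier_vec n" "w \<in> carrier_vec n"
  shows "v \<bullet> (A *\<^sub>v w) = w \<bullet> (A *\<^sub>v v)"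
proof -
  have "v \<bullet> (A *\<^sub>v w) = (A\<^sup>T *\<^sub>v v) \<bullet> w"
    using transpose_vec_mult_scalar[OF assms(1,4,3)] by simp
  also have "\<dots> = w \<bullet> (A *\<^sub>v v)"
    using assms by (simp add: comm_scalar_prod[of w n])
  finally show ?thesis .
qed

lemma quadratic_form_block:
  fixes A C D :: "real mat"
  assumes A: "A \<in> carrier_mat r r" and D: "D \<in> carrier_mat r s" and C: "C \<in> carrier_mat s s"
    and x: "x \<in> carrier_vec r" and z: "z \<in> carrier_vec s"
  shows "(x @\<^sub>v z) \<bullet> (four_block_mat A D D\<^sup>T C *\<^sub>v (x @\<^sub>v z))
    = x \<bullet> (A *\<^sub>v x) + 2 * (x \<bullet> (D *\<^sub>v z)) + z \<bullet> (C *\<^sub>v z)"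
proof -
  have DT: "D\<^sup>T \<in> carrier_mat s r" using D by simp
  have c: "A *\<^sub>v x \<in> carrier_vec r" "D *\<^sub>v z \<in> carrier_vec r" "D\<^sup>T *\<^sub>v x \<in> carrier_vec s"
    "C *\<^sub>v z \<in> carrier_vec s" using A D C x z by auto
  have "(x @\<^sub>v z) \<bullet> (four_block_mat A D D\<^sup>T C *\<^sub>v (x @\<^sub>v z))
    = (x @\<^sub>v z) \<bullet> ((A *\<^sub>v x + D *\<^sub>v z) @\<^sub>v (D\<^sup>T *\<^sub>v x + C *\<^sub>v z))"
    by (simp only: four_block_mat_mult_vec[OF A D DT C x z])
  also have "\<dots> = x \<bullet> (A *\<^sub>v x + D *\<^sub>v z) + z \<bullet> (D\<^sup>T *\<^sub>v x + C *\<^sub>v z)"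
    using c x z by (intro scalar_prod_append) auto
  also have "\<dots> = x \<bullet> (A *\<^sub>v x) + x \<bullet> (D *\<^sub>v z) + (z \<bullet> (D\<^sup>T *\<^sub>v x) + z \<bullet> (C *\<^sub>v z))"
    by (simp only: scalar_prod_add_distrib[OF x c(1,2)] scalar_prod_add_distrib[OF z c(3,4)])
  also have "z \<bullet> (D\<^sup>T *\<^sub>v x) = x \<bullet> (D *\<^sub>v z)"
    using transpose_vec_mult_scalar[OF D z x] comm_scalar_prod[OF z c(3)] by simp
  finally show ?thesis by simp
qed

lemma quadratic_form_add_smult:
  fixes A E :: "real mat"
  assumes "A \<in> carrier_mat n n" "E \<in> carrier_mat n n" "x \<in> carrier_vec n"
  shows "x \<bullet> ((A + t \<cdot>\<^sub>m E) *\<^sub>v x) = x \<bullet> (A *\<^sub>v x) + t * (x \<bullet> (E *\<^sub>v x))"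
proof -
  have "(t \<cdot>\<^sub>m E) *\<^sub>v x = t \<cdot>\<^sub>v (E *\<^sub>v x)" using assms by (intro eq_vecI) auto
  thus ?thesis using assms
    by (simp add: add_mult_distrib_mat_vec[of _ n n] scalar_prod_add_distrib[of _ n])
qed

lemma psd_lower_block:
  assumes M: "four_block_mat A D D\<^sup>T C \<in> psd_mats (r + q)"
    and A: "A \<in> carrier_mat r r" and D: "D \<in> carrier_mat r q" and C: "C \<in> sym_mats q"
  shows "C \<in> psd_mats q"
proof -
  have Cc: "C \<in> carrier_mat q q" using C by (simp add: sym_mats_def)
  have "0 \<le> z \<bullet> (C *\<^sub>v z)" if z: "z \<in> carrier_vec q" for z
  proof -
    have "0 \<le> (0\<^sub>v r @\<^sub>v z) \<bullet> (four_block_mat A D D\<^sup>T C *\<^sub>v (0\<^sub>v r @\<^sub>v z))"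
      using z by (intro psd_matsD(3)[OF M]) simp
    also have "\<dots> = z \<bullet> (C *\<^sub>v z)"
    proof -
      have "A *\<^sub>v 0\<^sub>v r \<in> carrier_vec r" "D *\<^sub>v z \<in> carrier_vec r" using A D z by auto
      thus ?thesis unfolding quadratic_form_block[OF A D Cc zero_carrier_vec z] by simp
    qed
    finally show ?thesis .
  qed
  thus ?thesis using C by (simp add: psd_mats_def)
qed

lemma affine_nonneg_imp_zero:
  fixes a b :: real
  assumes "\<And>t. 0 \<le> a + t * b"
  shows "b = 0"
proof (rule ccontr)
  assume "b \<noteq> 0"
  thus False using assms[of "- (a + 1) / b"] by simp
qed

text \<open>
  The quadratic form at \<open>(D z, t z)\<close> is affine in \<open>t\<close> with slope \<open>2 \<parallel>D z\<parallel>\<^sup>2\<close>, and an affine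
  function that is bounded below is constant.
\<close>

lemma psd_block_kernel:
  fixes A C D :: "real mat"
  assumes M: "four_block_mat A D D\<^sup>T C \<in> psd_mats (r + s)"
    and A: "A \<in> carrier_mat r r" and D: "D \<in> carrier_mat r s" and C: "C \<in> carrier_mat s s"
    and z: "z \<in> carrier_vec s" and Cz: "C *\<^sub>v z = 0\<^sub>v s"
  shows "D *\<^sub>v z = 0\<^sub>v r"
proof -
  define x where "x = D *\<^sub>v z"
  have x: "x \<in> carrier_vec r" using D z by (simp add: x_def)
  have "0 \<le> x \<bullet> (A *\<^sub>v x) + t * (2 * (x \<bullet> x))" for t
  proof -
    have tz: "t \<cdot>\<^sub>v z \<in> carrier_vec s" using z by simp
    have "0 \<le> (x @\<^sub>v (t \<cdot>\<^sub>v z)) \<bullet> (four_block_mat A D D\<^sup>T C *\<^sub>v (x @\<^sub>v (t \<cdot>\<^sub>v z)))"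
      using x tz by (intro psd_matsD(3)[OF M]) simp
    also have "\<dots> = x \<bullet> (A *\<^sub>v x) + 2 * (x \<bullet> (D *\<^sub>v (t \<cdot>\<^sub>v z))) + (t \<cdot>\<^sub>v z) \<bullet> (C *\<^sub>v (t \<cdot>\<^sub>v z))"
      by (rule quadratic_form_block[OF A D C x tz])
    also have "\<dots> = x \<bullet> (A *\<^sub>v x) + t * (2 * (x \<bullet> x))"
      using D C z x by (simp add: mult_mat_vec[of _ r s] mult_mat_vec[of _ s s] Cz x_def[symmetric])
    finally show ?thesis .
  qed
  hence "2 * (x \<bullet> x) = 0" by (rule affine_nonneg_imp_zero)
  hence "(\<Sum>i<r. x $ i * x $ i) = 0"
    using x by (simp add: scalar_prod_def atLeast0LessThan)
  hence "x $ i = 0" if "i < r" for i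
    using that by (subst (asm) sum_nonneg_eq_0_iff) auto
  thus ?thesis using x unfolding x_def[symmetric] by auto
qed

text \<open>
  \<open>B\<close> is \<open>D\<close> times the pseudoinverse of \<open>C\<close>; \<open>D\<close> kills the eigenvectors on which the
  pseudoinverse does not invert \<open>C\<close>.
\<close>

lemma factor_through_symmetric:
  fixes C D :: "real mat"
  assumes C: "C \<in> carrier_mat s s" and CT: "C\<^sup>T = C" and D: "D \<in> carrier_mat r s"
    and ker: "\<And>z. z \<in> carrier_vec s \<Longrightarrow> C *\<^sub>v z = 0\<^sub>v s \<Longrightarrow> D *\<^sub>v z = 0\<^sub>v r"
  shows "\<exists>B \<in> carrier_mat r s. D = B * C"
proof -
  obtain Q l where QO: "Q \<in> orthonormal_mats s" and Cl: "C = Q * mat_diag s l * Q\<^sup>T"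
    using real_spectral_theorem[OF C CT] by blast
  note Q = orthonormal_matsD[OF QO]
  let ?L = "mat_diag s l" and ?M = "mat_diag s (\<lambda>i. 1 / l i)"
  have DQ: "D * Q \<in> carrier_mat r s" using D Q by simp
  have LQ: "?L * Q\<^sup>T \<in> carrier_mat s s" and DQM: "D * Q * ?M \<in> carrier_mat r s"
    using Q DQ by (auto intro: mult_carrier_mat[OF DQ mat_diag_dim] mult_carrier_mat[OF mat_diag_dim Q(2)])
  have CQ: "C * Q = Q * ?L"
    unfolding Cl using Q LQ by (simp add: assoc_mult_mat[of _ s s _ s _ s])
  have zero: "(D * Q) $$ (i,j) = 0" if "i < r" "j < s" "l j = 0" for i j
  proof -
    have "C *\<^sub>v col Q j = col (C * Q) j" using col_mult2[OF C Q(1) that(2)] by simp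
    also have "\<dots> = 0\<^sub>v s"
      unfolding CQ mat_diag_mult_right[OF Q(1)] using that by (intro eq_vecI) auto
    finally have "D *\<^sub>v col Q j = 0\<^sub>v r" using Q by (intro ker) auto
    hence "col (D * Q) j = 0\<^sub>v r" using col_mult2[OF D Q(1) that(2)] by simp
    hence "col (D * Q) j $ i = 0\<^sub>v r $ i" by simp
    thus ?thesis using that DQ D Q by simp
  qed
  (* Division by zero makes the diagonal of 1 / l the pseudoinverse of the diagonal of l. *)
  define B where "B = D * Q * ?M * Q\<^sup>T"
  have "B * C = D * Q * ?M * (Q\<^sup>T * (Q * (?L * Q\<^sup>T)))"
    unfolding B_def Cl assoc_mult_mat[OF Q(1) mat_diag_dim Q(2)]
    by (rule assoc_mult_mat[OF DQM Q(2) mult_carrier_mat[OF Q(1) LQ]])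
  also have "\<dots> = D * Q * ?M * ?L * Q\<^sup>T"
    using orthonormal_cancel(1)[OF QO LQ] assoc_mult_mat[OF DQM mat_diag_dim Q(2)] by simp
  also have "D * Q * ?M * ?L = D * Q"
  proof (rule eq_matI)
    fix i j assume "i < dim_row (D * Q)" "j < dim_col (D * Q)"
    hence ij: "i < r" "j < s" using D Q by auto
    have "(D * Q * ?M * ?L) $$ (i,j) = (D * Q * ?M) $$ (i,j) * l j"
      unfolding mat_diag_mult_right[OF DQM] using ij by (simp del: index_mult_mat)
    also have "(D * Q * ?M) $$ (i,j) = (D * Q) $$ (i,j) * (1 / l j)"
      unfolding mat_diag_mult_right[OF DQ] using ij by (simp del: index_mult_mat)
    finally show "(D * Q * ?M * ?L) $$ (i,j) = (D * Q) $$ (i,j)"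
      using zero[OF ij] by (cases "l j = 0") (simp_all del: index_mult_mat)
  qed (use D Q in auto)
  also have "D * Q * Q\<^sup>T = D" using D Q by (simp add: assoc_mult_mat[OF D Q(1) Q(2)])
  finally have "D = B * C" ..
  moreover have "B \<in> carrier_mat r s" unfolding B_def by (rule mult_carrier_mat[OF DQM Q(2)])
  ultimately show ?thesis by blast
qed

lemma complete_square:
  fixes B C :: "real mat"
  assumes B: "B \<in> carrier_mat r q" and C: "C \<in> carrier_mat q q" and CT: "C\<^sup>T = C"
    and x: "x \<in> carrier_vec r" and z: "z \<in> carrier_vec q"
  shows "(z + B\<^sup>T *\<^sub>v x) \<bullet> (C *\<^sub>v (z + B\<^sup>T *\<^sub>v x))
    = z \<bullet> (C *\<^sub>v z) + 2 * (x \<bullet> ((B * C) *\<^sub>v z)) + x \<bullet> ((B * C * B\<^sup>T) *\<^sub>v x)"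
proof -
  define u where "u = B\<^sup>T *\<^sub>v x"
  have u: "u \<in> carrier_vec q" using B x by (simp add: u_def)
  have BC: "B * C \<in> carrier_mat r q" using B C by simp
  have c: "C *\<^sub>v z \<in> carrier_vec q" "C *\<^sub>v u \<in> carrier_vec q" using C z u by auto
  have move: "x \<bullet> (B *\<^sub>v w) = u \<bullet> w" if "w \<in> carrier_vec q" for w
    unfolding u_def by (rule transpose_vec_mult_scalar[OF B that x, symmetric])
  have "(z + u) \<bullet> (C *\<^sub>v (z + u)) = z \<bullet> (C *\<^sub>v z) + z \<bullet> (C *\<^sub>v u) + (u \<bullet> (C *\<^sub>v z) + u \<bullet> (C *\<^sub>v u))"
    unfolding mult_add_distrib_mat_vec[OF C z u]
    by (simp only: add_scalar_prod_distrib[OF z u add_carrier_vec[OF c]]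
        scalar_prod_add_distrib[OF z c] scalar_prod_add_distrib[OF u c])
  also have "z \<bullet> (C *\<^sub>v u) = u \<bullet> (C *\<^sub>v z)" by (rule scalar_prod_symmetric[OF C CT z u])
  also have "u \<bullet> (C *\<^sub>v z) = x \<bullet> ((B * C) *\<^sub>v z)"
    using move[OF c(1)] assoc_mult_mat_vec[OF B C z] by simp
  also have "u \<bullet> (C *\<^sub>v u) = x \<bullet> ((B * C * B\<^sup>T) *\<^sub>v x)"
    using move[OF c(2)] assoc_mult_mat_vec[OF B C u] assoc_mult_mat_vec[OF BC _ x, of "B\<^sup>T"] B
    by (simp add: u_def)
  finally show ?thesis unfolding u_def by simp
qed

section \<open>The radial cone of the positive semidefinite cone\<close>

lemma quadratic_form_lower_bound:
  fixes E :: "real mat"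
  assumes E: "E \<in> carrier_mat r r"
  shows "\<exists>K \<ge> 0. \<forall>x \<in> carrier_vec r. - K * (x \<bullet> x) \<le> x \<bullet> (E *\<^sub>v x)"
proof -
  define K where "K = (\<Sum>i<r. \<Sum>j<r. \<bar>E $$ (i,j)\<bar>)"
  have "- K * (x \<bullet> x) \<le> x \<bullet> (E *\<^sub>v x)" if x: "x \<in> carrier_vec r" for x
  proof -
    have xx: "x \<bullet> x = (\<Sum>i<r. (x $ i)\<^sup>2)"
      using x by (simp add: scalar_prod_def atLeast0LessThan power2_eq_square)
    have le: "(x $ i)\<^sup>2 \<le> x \<bullet> x" if "i < r" for i
      unfolding xx by (rule member_le_sum) (use that in auto)
    have "- \<bar>E $$ (i,j)\<bar> * (x \<bullet> x) \<le> x $ i * (E $$ (i,j) * x $ j)" if "i < r" "j < r" for i j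
    proof -
      have "\<bar>x $ i * x $ j\<bar> \<le> x \<bullet> x"
        using sum_squares_bound[of "\<bar>x $ i\<bar>" "\<bar>x $ j\<bar>"] le[OF that(1)] le[OF that(2)]
        by (simp add: abs_mult)
      hence "\<bar>E $$ (i,j)\<bar> * \<bar>x $ i * x $ j\<bar> \<le> \<bar>E $$ (i,j)\<bar> * (x \<bullet> x)"
        by (intro mult_left_mono) auto
      moreover have "- (\<bar>E $$ (i,j)\<bar> * \<bar>x $ i * x $ j\<bar>) \<le> x $ i * (E $$ (i,j) * x $ j)"
        using abs_ge_minus_self[of "E $$ (i,j) * (x $ i * x $ j)"]
        by (simp add: abs_mult algebra_simps)
      ultimately show ?thesis by simp
    qed
    hence "(\<Sum>i<r. \<Sum>j<r. - \<bar>E $$ (i,j)\<bar> * (x \<bullet> x)) \<le> (\<Sum>i<r. \<Sum>j<r. x $ i * (E $$ (i,j) * x $ j))"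
      by (intro sum_mono) auto
    also have "\<dots> = x \<bullet> (E *\<^sub>v x)"
      using x E by (simp add: scalar_prod_def atLeast0LessThan sum_distrib_left)
    also have "(\<Sum>i<r. \<Sum>j<r. - \<bar>E $$ (i,j)\<bar> * (x \<bullet> x)) = - K * (x \<bullet> x)"
      by (simp only: K_def sum_negf sum_distrib_right mult_minus_left)
    finally show ?thesis .
  qed
  moreover have "K \<ge> 0" by (simp add: K_def sum_nonneg)
  ultimately show ?thesis by blast
qed

text \<open>
  The diagonal form is at least \<open>\<delta> \<parallel>x\<parallel>\<^sup>2\<close> for some \<open>\<delta> > 0\<close>, while the form of \<open>E\<close> is bounded below by
  \<open>- K \<parallel>x\<parallel>\<^sup>2\<close>; any \<open>\<epsilon>\<close> with \<open>\<epsilon> K \<le> \<delta>\<close> works.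
\<close>

lemma positive_diagonal_perturbation:
  fixes E :: "real mat"
  assumes E: "E \<in> carrier_mat r r" and s: "\<And>i. i < r \<Longrightarrow> 0 < s i"
  shows "\<exists>\<epsilon> > 0. \<forall>x \<in> carrier_vec r. 0 \<le> x \<bullet> (mat_diag r s *\<^sub>v x) + \<epsilon> * (x \<bullet> (E *\<^sub>v x))"
proof -
  obtain K where K: "K \<ge> 0" "\<And>x. x \<in> carrier_vec r \<Longrightarrow> - K * (x \<bullet> x) \<le> x \<bullet> (E *\<^sub>v x)"
    using quadratic_form_lower_bound[OF E] by blast
  (* The element 1 keeps the set nonempty when r = 0. *)
  define \<delta> where "\<delta> = Min (insert 1 (s ` {..<r}))"
  have \<delta>: "\<delta> > 0" "\<And>i. i < r \<Longrightarrow> \<delta> \<le> s i" using s by (auto simp: \<delta>_def)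
  define \<epsilon> where "\<epsilon> = \<delta> / (K + 1)"
  have \<epsilon>: "\<epsilon> > 0" "\<epsilon> * K \<le> \<delta>" using K \<delta> by (auto simp: \<epsilon>_def field_simps)
  have "0 \<le> x \<bullet> (mat_diag r s *\<^sub>v x) + \<epsilon> * (x \<bullet> (E *\<^sub>v x))" if x: "x \<in> carrier_vec r" for x
  proof -
    have xx: "x \<bullet> x = (\<Sum>i<r. (x $ i)\<^sup>2)"
      using x by (simp add: scalar_prod_def atLeast0LessThan power2_eq_square)
    have Dx: "mat_diag r s *\<^sub>v x = vec r (\<lambda>i. s i * x $ i)"
    proof (rule eq_vecI)
      fix i assume i: "i < dim_vec (vec r (\<lambda>i. s i * x $ i))"
      have "(mat_diag r s *\<^sub>v x) $ i = (\<Sum>j<r. (if i = j then s j else 0) * x $ j)"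
        using i x by (simp add: scalar_prod_def atLeast0LessThan)
      also have "\<dots> = (\<Sum>j<r. if i = j then s j * x $ j else 0)"
        by (intro sum.cong) auto
      finally show "(mat_diag r s *\<^sub>v x) $ i = vec r (\<lambda>i. s i * x $ i) $ i" using i by simp
    qed simp
    have "\<delta> * (x \<bullet> x) \<le> x \<bullet> (mat_diag r s *\<^sub>v x)"
    proof -
      have "x \<bullet> (mat_diag r s *\<^sub>v x) = (\<Sum>i<r. s i * (x $ i)\<^sup>2)"
        unfolding Dx using x
        by (simp add: scalar_prod_def atLeast0LessThan power2_eq_square ac_simps)
      thus ?thesis unfolding xx sum_distrib_left
        using \<delta>(2) by (auto intro!: sum_mono mult_right_mono)
    qed
    moreover have "\<epsilon> * (- K * (x \<bullet> x)) \<le> \<epsilon> * (x \<bullet> (E *\<^sub>v x))"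
      using K(2)[OF x] \<epsilon>(1) by (intro mult_left_mono) auto
    moreover have "\<epsilon> * K * (x \<bullet> x) \<le> \<delta> * (x \<bullet> x)"
      using \<epsilon>(2) by (intro mult_right_mono) (auto simp: xx sum_nonneg)
    ultimately show ?thesis by (simp add: algebra_simps)
  qed
  with \<epsilon>(1) show ?thesis by blast
qed

text \<open>
  A feasible direction \<open>t (S - \<Sigma>)\<close> agrees with \<open>t S\<close> in its last block column, which inherits the
  factorization \<open>D = B C\<close> from \<open>S\<close>. Conversely, for \<open>M\<close> on the right-hand side the matrix
  \<open>\<Sigma> + \<epsilon> M\<close> is positive semidefinite for some \<open>\<epsilon> > 0\<close>, because after completing the square only
  the perturbation \<open>\<epsilon> (A - B C B\<^sup>T)\<close> of the positive diagonal block remains.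
\<close>

theorem radial_cone_psd_mats:
  assumes rp: "r \<le> p" and s: "\<And>i. i < r \<Longrightarrow> 0 < s i" and s0: "\<And>i. r \<le> i \<Longrightarrow> i < p \<Longrightarrow> s i = 0"
  shows "radial_cone (psd_mats p) (mat_diag p s) =
    {four_block_mat A (B * C) (C\<^sup>T * B\<^sup>T) C
     | A B C. A \<in> sym_mats r \<and> B \<in> carrier_mat r (p - r) \<and> C \<in> psd_mats (p - r)}" (is "?L = ?R")
proof (intro equalityI subsetI)
  define q where "q = p - r"
  have p: "p = r + q" using rp by (simp add: q_def)
  have Sig: "mat_diag p s = four_block_mat (mat_diag r s) (0\<^sub>m r q) (0\<^sub>m q r) (0\<^sub>m q q)"
    unfolding p by (rule eq_matI) (use s0 p in auto)
  {
    fix M assume "M \<in> ?L"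
    then obtain t S where t: "0 \<le> t" and S: "S \<in> psd_mats p" and M: "M = t \<cdot>\<^sub>m (S - mat_diag p s)"
      by (auto simp: radial_cone_def)
    have "S \<in> sym_mats (r + q)" using S p by (simp add: psd_mats_def)
    then obtain A D C where S_eq: "S = four_block_mat A D D\<^sup>T C" and A: "A \<in> sym_mats r"
      and D: "D \<in> carrier_mat r q" and C: "C \<in> sym_mats q"
      by (rule symmetric_block_split)
    have Ac: "A \<in> carrier_mat r r" "A\<^sup>T = A" and Cc: "C \<in> carrier_mat q q" "C\<^sup>T = C"
      using A C by (auto simp: sym_mats_def)
    have S': "four_block_mat A D D\<^sup>T C \<in> psd_mats (r + q)" using S S_eq p by simp
    obtain B where B: "B \<in> carrier_mat r q" and DB: "D = B * C"
      using factor_through_symmetric[OF Cc D psd_block_kernel[OF S' Ac(1) D Cc(1)]] by blast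
    have C': "t \<cdot>\<^sub>m C \<in> psd_mats q" by (intro psd_smult psd_lower_block[OF S' Ac(1) D C] t)
    have A': "t \<cdot>\<^sub>m (A - mat_diag r s) \<in> sym_mats r"
      using Ac(1) sym_mats_index[OF A] by (auto simp: sym_mats_def intro!: eq_matI)
    have tD: "t \<cdot>\<^sub>m D = B * (t \<cdot>\<^sub>m C)" unfolding DB using B Cc by (simp add: mult_smult_distrib[of _ r q])
    have tDT: "(t \<cdot>\<^sub>m C)\<^sup>T * B\<^sup>T = (t \<cdot>\<^sub>m D)\<^sup>T" unfolding tD
      by (rule transpose_mult[symmetric, OF B, of _ q]) (use Cc in simp)
    have "M = four_block_mat (t \<cdot>\<^sub>m (A - mat_diag r s)) (t \<cdot>\<^sub>m D) ((t \<cdot>\<^sub>m D)\<^sup>T) (t \<cdot>\<^sub>m C)"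
      unfolding M S_eq Sig by (rule eq_matI) (use Ac D Cc in auto)
    hence "M = four_block_mat (t \<cdot>\<^sub>m (A - mat_diag r s)) (B * (t \<cdot>\<^sub>m C)) ((t \<cdot>\<^sub>m C)\<^sup>T * B\<^sup>T) (t \<cdot>\<^sub>m C)"
      unfolding tDT tD[symmetric] .
    thus "M \<in> ?R" using A' B C' unfolding q_def by blast
  next
    fix M assume "M \<in> ?R"
    then obtain A B C where M: "M = four_block_mat A (B * C) (C\<^sup>T * B\<^sup>T) C"
      and A: "A \<in> sym_mats r" and B: "B \<in> carrier_mat r q" and C: "C \<in> psd_mats q"
      unfolding q_def by blast
    note Cc = psd_matsD[OF C]
    have Ac: "A \<in> carrier_mat r r" using A by (simp add: sym_mats_def)
    (* Conversely, D is the off-diagonal block and F the correction from completing the square. *)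
    define D where "D = B * C"
    have D: "D \<in> carrier_mat r q" using B Cc by (simp add: D_def)
    have DT: "C\<^sup>T * B\<^sup>T = D\<^sup>T" unfolding D_def by (rule transpose_mult[OF B Cc(1), symmetric])
    define F where "F = B * C * B\<^sup>T"
    have F: "F \<in> carrier_mat r r" using B Cc by (simp add: F_def)
    define E where "E = A - F"
    have E: "E \<in> carrier_mat r r" using Ac F by (simp add: E_def minus_carrier_mat)
    obtain \<epsilon> where \<epsilon>: "\<epsilon> > 0"
      and pos: "\<And>x. x \<in> carrier_vec r \<Longrightarrow> 0 \<le> x \<bullet> (mat_diag r s *\<^sub>v x) + \<epsilon> * (x \<bullet> (E *\<^sub>v x))"
      using positive_diagonal_perturbation[OF E, of s] s by blast
    define S where "S = four_block_mat (mat_diag r s + \<epsilon> \<cdot>\<^sub>m A) (\<epsilon> \<cdot>\<^sub>m D) ((\<epsilon> \<cdot>\<^sub>m D)\<^sup>T) (\<epsilon> \<cdot>\<^sub>m C)"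
    have c: "mat_diag r s + \<epsilon> \<cdot>\<^sub>m A \<in> carrier_mat r r" "\<epsilon> \<cdot>\<^sub>m D \<in> carrier_mat r q" "\<epsilon> \<cdot>\<^sub>m C \<in> carrier_mat q q"
      using Ac D Cc by auto
    have "S \<in> psd_mats p"
    proof -
      have "mat_diag r s + \<epsilon> \<cdot>\<^sub>m A \<in> sym_mats r"
        using Ac sym_mats_index[OF A] by (auto simp: sym_mats_def intro!: eq_matI)
      moreover have "\<epsilon> \<cdot>\<^sub>m C \<in> sym_mats q" using psd_smult[OF C, of \<epsilon>] \<epsilon> by (simp add: psd_mats_def)
      ultimately have "S \<in> sym_mats p" unfolding S_def p using c(2) by (intro block_sym_mats)
      moreover have "0 \<le> v \<bullet> (S *\<^sub>v v)" if v: "v \<in> carrier_vec p" for v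
      proof -
        define x where "x = vec_first v r"
        define z where "z = vec_last v q"
        have x: "x \<in> carrier_vec r" and z: "z \<in> carrier_vec q" by (auto simp: x_def z_def)
        have vxz: "v = x @\<^sub>v z" unfolding x_def z_def using v p by simp
        define w where "w = z + B\<^sup>T *\<^sub>v x"
        have w: "w \<in> carrier_vec q" using z x B by (simp add: w_def)
        have eD: "x \<bullet> ((\<epsilon> \<cdot>\<^sub>m D) *\<^sub>v z) = \<epsilon> * (x \<bullet> (D *\<^sub>v z))"
        proof -
          have "(\<epsilon> \<cdot>\<^sub>m D) *\<^sub>v z = \<epsilon> \<cdot>\<^sub>v (D *\<^sub>v z)" using D z by (intro eq_vecI) auto
          thus ?thesis using D x z by simp
        qed
        have eC: "z \<bullet> ((\<epsilon> \<cdot>\<^sub>m C) *\<^sub>v z) = \<epsilon> * (z \<bullet> (C *\<^sub>v z))"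
        proof -
          have "(\<epsilon> \<cdot>\<^sub>m C) *\<^sub>v z = \<epsilon> \<cdot>\<^sub>v (C *\<^sub>v z)" using Cc z by (intro eq_vecI) auto
          thus ?thesis using Cc z by simp
        qed
        have xE: "x \<bullet> (E *\<^sub>v x) = x \<bullet> (A *\<^sub>v x) - x \<bullet> (F *\<^sub>v x)"
          unfolding E_def using Ac F x
          by (simp add: minus_mult_distrib_mat_vec[of _ r r] scalar_prod_minus_distrib[of _ r])
        have sq: "w \<bullet> (C *\<^sub>v w) = z \<bullet> (C *\<^sub>v z) + 2 * (x \<bullet> (D *\<^sub>v z)) + x \<bullet> (F *\<^sub>v x)"
          unfolding w_def D_def F_def by (rule complete_square[OF B Cc(1,2) x z])
        have "v \<bullet> (S *\<^sub>v v) = x \<bullet> (mat_diag r s *\<^sub>v x) + \<epsilon> * (x \<bullet> (A *\<^sub>v x))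
            + 2 * (\<epsilon> * (x \<bullet> (D *\<^sub>v z))) + \<epsilon> * (z \<bullet> (C *\<^sub>v z))"
          unfolding vxz S_def quadratic_form_block[OF c x z] eD eC
            quadratic_form_add_smult[OF mat_diag_dim Ac x] ..
        also have "\<dots> = (x \<bullet> (mat_diag r s *\<^sub>v x) + \<epsilon> * (x \<bullet> (E *\<^sub>v x))) + \<epsilon> * (w \<bullet> (C *\<^sub>v w))"
          unfolding sq xE by (simp add: algebra_simps)
        also have "\<dots> \<ge> 0" using pos[OF x] Cc(3)[OF w] \<epsilon> by simp
        finally show ?thesis .
      qed
      ultimately show ?thesis by (simp add: psd_mats_def)
    qed
    moreover have "M = (1 / \<epsilon>) \<cdot>\<^sub>m (S - mat_diag p s)"
      unfolding M DT D_def[symmetric] S_def Sig by (rule eq_matI) (use Ac D Cc \<epsilon> in auto)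
    moreover have "0 \<le> 1 / \<epsilon>" using \<epsilon> by simp
    ultimately show "M \<in> ?L" unfolding radial_cone_def by blast
  }
qed

lemma radial_cone_image:
  assumes lin: "\<And>t W. W \<in> \<Omega> \<Longrightarrow> f (t \<cdot>\<^sub>m (W - X)) = t \<cdot>\<^sub>m (f W - f X)"
  shows "radial_cone (f ` \<Omega>) (f X) = f ` radial_cone \<Omega> X"
  unfolding radial_cone_def using lin by (auto simp: image_iff) (metis lin)+

lemma orthonormal_corner_linear:
  assumes U: "U \<in> carrier_mat n n" and V: "V \<in> carrier_mat m m"
    and S: "S \<in> carrier_mat p p" and T: "T \<in> carrier_mat p p" and pn: "p \<le> n" and pm: "p \<le> m"
  shows "U * corner n m p (t \<cdot>\<^sub>m (S - T)) * V\<^sup>T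
    = t \<cdot>\<^sub>m (U * corner n m p S * V\<^sup>T - U * corner n m p T * V\<^sup>T)"
proof -
  let ?c = "corner n m p"
  have ST: "t \<cdot>\<^sub>m (S - T) \<in> carrier_mat p p" using T by (simp add: minus_carrier_mat)
  note C = corner_carrier[OF S pn pm] corner_carrier[OF T pn pm] corner_carrier[OF ST pn pm]
  have VT: "V\<^sup>T \<in> carrier_mat m m" using V by simp
  have "?c (t \<cdot>\<^sub>m (S - T)) = t \<cdot>\<^sub>m (?c S - ?c T)"
  proof (rule eq_matI)
    fix i j assume "i < dim_row (t \<cdot>\<^sub>m (?c S - ?c T))" "j < dim_col (t \<cdot>\<^sub>m (?c S - ?c T))"
    hence ij: "i < n" "j < m" using C by auto
    show "?c (t \<cdot>\<^sub>m (S - T)) $$ (i,j) = (t \<cdot>\<^sub>m (?c S - ?c T)) $$ (i,j)"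
      using C(1,2) ij S T
      by (simp add: index_corner[OF S pn pm ij] index_corner[OF T pn pm ij] index_corner[OF ST pn pm ij])
  qed (use C in auto)
  moreover have "U * (t \<cdot>\<^sub>m (?c S - ?c T)) * V\<^sup>T = t \<cdot>\<^sub>m (U * ?c S * V\<^sup>T - U * ?c T * V\<^sup>T)"
    using U VT C(1,2) mult_smult_distrib[OF U minus_carrier_mat[OF C(2)], of t "?c S"]
      mult_minus_distrib_mat[OF U C(1,2)]
      minus_mult_distrib_mat[OF mult_carrier_mat[OF U C(1)] mult_carrier_mat[OF U C(2)] VT]
      mult_smult_assoc_mat[OF minus_carrier_mat[OF mult_carrier_mat[OF U C(2)], of "U * ?c S"] VT, of t]
    by simp
  ultimately show ?thesis by simp
qed

section \<open>Singular values of a subgradient, and the rank\<close>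

lemma nuclear_norm_orthonormal_rect_diag:
  assumes U: "U \<in> orthonormal_mats n" and V: "V \<in> orthonormal_mats m" and nm: "n \<le> m"
    and a: "\<And>i. i < n \<Longrightarrow> 0 \<le> a i"
  shows "nuclear_norm (U * rect_diag n m a * V\<^sup>T) = (\<Sum>i<n. a i)"
proof -
  have one: "1\<^sub>m n \<in> orthonormal_mats n" by (simp add: orthonormal_mats_def)
  show ?thesis
    using nuclear_norm_eq_sum[OF one rect_diag_carrier rect_diag_gram[OF nm] a]
    by (simp add: nuclear_norm_def singvals_orthonormal_mult[OF U V rect_diag_carrier]
        left_mult_one_mat[OF rect_diag_carrier])
qed

lemma frob_inner_rect_diag:
  assumes "n \<le> m"
  shows "frob_inner (rect_diag n m a) (rect_diag n m b) = (\<Sum>i<n. a i * b i)"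
proof -
  have "frob_inner (rect_diag n m a) (rect_diag n m b) = (\<Sum>i<n. \<Sum>j<m. if i = j then a i * b i else 0)"
    unfolding frob_inner_sum[OF rect_diag_carrier rect_diag_carrier] by (intro sum.cong) auto
  also have "\<dots> = (\<Sum>i<n. a i * b i)" using assms by (intro sum.cong) auto
  finally show ?thesis .
qed

text \<open>
  The subgradient inequality is tested at the matrices that arise from \<open>X\<close> by replacing a single
  singular value \<open>s\<^sub>j\<close> by \<open>c \<ge> 0\<close>. It becomes \<open>y\<^sub>j (c - s\<^sub>j) \<le> c - s\<^sub>j\<close>; \<open>c > s\<^sub>j\<close> gives the upper
  bound, and \<open>c = 0\<close> the lower bound when \<open>s\<^sub>j > 0\<close>.
\<close>

lemma subgradient_singvals:
  assumes nm: "n \<le> m" and U: "U \<in> orthonormal_mats n" and V: "V \<in> orthonormal_mats m"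
    and X: "X = U * rect_diag n m s * V\<^sup>T" and Y: "Y = U * rect_diag n m y * V\<^sup>T"
    and s: "\<And>i. i < n \<Longrightarrow> 0 \<le> s i"
    and sub: "Y \<in> subdifferential n m (\<lambda>Z. ereal (nuclear_norm Z)) X" and j: "j < n"
  shows "y j \<le> 1" and "0 < s j \<Longrightarrow> y j = 1"
proof -
  have test: "(\<Sum>i<n. s i) + ((\<Sum>i<n. y i * a i) - (\<Sum>i<n. y i * s i)) \<le> (\<Sum>i<n. a i)"
    if a: "\<And>i. i < n \<Longrightarrow> 0 \<le> a i" for a
  proof -
    let ?Z = "U * rect_diag n m a * V\<^sup>T"
    note UD = orthonormal_matsD[OF U] and VD = orthonormal_matsD[OF V]
    have c: "U * rect_diag n m b * V\<^sup>T \<in> carrier_mat n m" for b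
      by (rule mult_carrier_mat[OF mult_carrier_mat[OF UD(1) rect_diag_carrier] VD(2)])
    have f: "frob_inner Y (U * rect_diag n m b * V\<^sup>T) = (\<Sum>i<n. y i * b i)" for b
      unfolding Y frob_inner_orthonormal[OF U V rect_diag_carrier rect_diag_carrier]
      by (rule frob_inner_rect_diag[OF nm])
    have "ereal (nuclear_norm X) + ereal (frob_inner Y (?Z - X)) \<le> ereal (nuclear_norm ?Z)"
      using sub c[of a] unfolding subdifferential_def by blast
    hence "nuclear_norm X + frob_inner Y (?Z - X) \<le> nuclear_norm ?Z" by simp
    moreover have "frob_inner Y (?Z - X) = (\<Sum>i<n. y i * a i) - (\<Sum>i<n. y i * s i)"
      using frob_inner_diff_right[of Y n m ?Z X] c[of a] c[of s] c[of y] f[of a] f[of s]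
      by (simp add: X[symmetric] Y[symmetric])
    moreover have "nuclear_norm X = (\<Sum>i<n. s i)" "nuclear_norm ?Z = (\<Sum>i<n. a i)"
      unfolding X by (intro nuclear_norm_orthonormal_rect_diag[OF U V nm]; simp add: s a)+
    ultimately show ?thesis by simp
  qed
  have upd: "(\<Sum>i<n. y i * (s(j := c)) i) - (\<Sum>i<n. y i * s i) = y j * (c - s j)"
    "(\<Sum>i<n. (s(j := c)) i) - (\<Sum>i<n. s i) = c - s j" for c
  proof -
    have "(\<Sum>i<n. y i * (s(j := c)) i - y i * s i) = (\<Sum>i<n. if i = j then y j * (c - s j) else 0)"
      by (intro sum.cong) (auto simp: algebra_simps)
    thus "(\<Sum>i<n. y i * (s(j := c)) i) - (\<Sum>i<n. y i * s i) = y j * (c - s j)"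
      using j by (simp add: sum_subtractf)
    have "(\<Sum>i<n. (s(j := c)) i - s i) = (\<Sum>i<n. if i = j then c - s j else 0)"
      by (intro sum.cong) auto
    thus "(\<Sum>i<n. (s(j := c)) i) - (\<Sum>i<n. s i) = c - s j"
      using j by (simp add: sum_subtractf)
  qed
  have dir: "y j * (c - s j) \<le> c - s j" if "0 \<le> c" for c
    using test[of "s(j := c)"] upd[of c] s that by (simp del: fun_upd_apply) (force simp: fun_upd_apply)
  show le: "y j \<le> 1" using dir[of "s j + 1"] s[OF j] by simp
  assume "0 < s j"
  thus "y j = 1" using dir[of 0] le by simp
qed

text \<open>
  Singular values are sorted, so counting those that equal 1, or those that are positive, also
  tells which indices they have.
\<close>

lemma downward_closed_eq_lessThan_card:
  fixes A :: "nat set"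
  assumes "finite A" "\<And>i j. j \<in> A \<Longrightarrow> i \<le> j \<Longrightarrow> i \<in> A"
  shows "A = {..<card A}"
proof (cases "A = {}")
  case False
  hence "A = {..Max A}" using assms by (auto intro: Max_in)
  hence "A = {..<Suc (Max A)}" by (simp add: lessThan_Suc_atMost)
  thus ?thesis by (metis card_lessThan)
qed simp

text \<open>
  The two factorizations say that \<open>X\<close> and \<open>A\<close> have the same column space.
\<close>

lemma rank_eq_of_factorizations:
  fixes X A :: "real mat"
  assumes X: "X \<in> carrier_mat n m" and A: "A \<in> carrier_mat n k"
    and K: "K \<in> carrier_mat k m" "X = A * K" and L: "L \<in> carrier_mat m k" "A = X * L"
  shows "vec_space.rank n X = vec_space.rank n A"
proof -
  interpret vec_space "TYPE(real)" n .
  have "col_space X \<subseteq> col_space A"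
  proof
    fix y assume "y \<in> col_space X"
    then obtain x where x: "x \<in> carrier_vec m" "y = X *\<^sub>v x" using X unfolding col_space_eq[OF X] by auto
    hence "y = A *\<^sub>v (K *\<^sub>v x)" using assoc_mult_mat_vec[OF A K(1) x(1)] K(2) by simp
    thus "y \<in> col_space A" using A K x unfolding col_space_eq[OF A] by auto
  qed
  moreover have "col_space A \<subseteq> col_space X"
  proof
    fix y assume "y \<in> col_space A"
    then obtain x where x: "x \<in> carrier_vec k" "y = A *\<^sub>v x" using A unfolding col_space_eq[OF A] by auto
    hence "y = X *\<^sub>v (L *\<^sub>v x)" using assoc_mult_mat_vec[OF X L(1) x(1)] L(2) by simp
    thus "y \<in> col_space X" using X L x unfolding col_space_eq[OF X] by auto
  qed
  ultimately have "span (set (cols X)) = span (set (cols A))" unfolding col_space_def by simp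
  thus ?thesis by (simp add: rank_def)
qed

lemma rank_orthonormal_columns:
  fixes A :: "real mat"
  assumes A: "A \<in> carrier_mat n k" and AA: "A\<^sup>T * A = 1\<^sub>m k"
  shows "vec_space.rank n A = k"
proof -
  interpret vec_space "TYPE(real)" n .
  have dist: "distinct (cols A)"
    unfolding distinct_conv_nth
  proof (intro allI impI)
    fix i j assume "i < length (cols A)" "j < length (cols A)" "i \<noteq> j"
    hence ij: "i < k" "j < k" "i \<noteq> j" using A by auto
    show "cols A ! i \<noteq> cols A ! j"
    proof
      assume "cols A ! i = cols A ! j"
      hence "(A\<^sup>T * A) $$ (i,i) = (A\<^sup>T * A) $$ (i,j)" using ij A by simp
      thus False using ij by (simp add: AA)
    qed
  qed
  have "\<not> lin_dep (set (cols A))"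
  proof
    assume "lin_dep (set (cols A))"
    then obtain v where v: "v \<in> carrier_vec k" "v \<noteq> 0\<^sub>v k" "A *\<^sub>v v = 0\<^sub>v n"
      using lin_depE[OF A _ dist] by blast
    have "v = A\<^sup>T *\<^sub>v (A *\<^sub>v v)" using assoc_mult_mat_vec[of "A\<^sup>T" k n A k v] A v AA by simp
    also have "\<dots> = 0\<^sub>v k" unfolding v(3) using A by (intro eq_vecI) auto
    finally show False using v(2) by simp
  qed
  thus ?thesis by (rule lin_indpt_full_rank[OF A dist])
qed

text \<open>
  The column space is spanned by the first \<open>k\<close> columns of \<open>U\<close>.
\<close>

lemma rank_orthonormal_rect_diag:
  assumes U: "U \<in> orthonormal_mats n" and V: "V \<in> orthonormal_mats m" and kn: "k \<le> n" and nm: "n \<le> m"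
    and s: "\<And>i. i < k \<Longrightarrow> s i \<noteq> 0" and s0: "\<And>i. k \<le> i \<Longrightarrow> i < n \<Longrightarrow> s i = 0"
  shows "vec_space.rank n (U * rect_diag n m s * V\<^sup>T) = k"
proof -
  note UD = orthonormal_matsD[OF U] and VD = orthonormal_matsD[OF V]
  have km: "k \<le> m" using kn nm by simp
  let ?X = "U * rect_diag n m s * V\<^sup>T"
  define A where "A = mat n k (\<lambda>(i,j). U $$ (i,j))"
  define K where "K = mat k m (\<lambda>(i,j). s i * V $$ (j,i))"
  define L where "L = mat m k (\<lambda>(i,j). V $$ (i,j) / s j)"
  have A: "A \<in> carrier_mat n k" and K: "K \<in> carrier_mat k m" and L: "L \<in> carrier_mat m k"
    by (auto simp: A_def K_def L_def)
  have UR: "U * rect_diag n m s \<in> carrier_mat n m" by (rule mult_carrier_mat[OF UD(1) rect_diag_carrier])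
  have X: "?X \<in> carrier_mat n m" by (rule mult_carrier_mat[OF UR VD(2)])
  have URi: "(U * rect_diag n m s) $$ (i,l) = (if l < n then U $$ (i,l) * s l else 0)"
    if "i < n" "l < m" for i l
  proof -
    have "(U * rect_diag n m s) $$ (i,l) = (\<Sum>q<n. U $$ (i,q) * (if q = l then s q else 0))"
      using that UD(1) by (simp add: scalar_prod_def atLeast0LessThan rect_diag_def)
    also have "\<dots> = (\<Sum>q<n. if q = l then U $$ (i,l) * s l else 0)" by (intro sum.cong) auto
    finally show ?thesis by simp
  qed
  have Xi: "?X $$ (i,j) = (\<Sum>l<k. U $$ (i,l) * (s l * V $$ (j,l)))" if "i < n" "j < m" for i j
  proof -
    have "?X $$ (i,j) = (\<Sum>l<m. (U * rect_diag n m s) $$ (i,l) * V $$ (j,l))"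
      by (rule mult_transpose_index[OF UR VD(1) that])
    also have "\<dots> = (\<Sum>l<m. if l < k then U $$ (i,l) * (s l * V $$ (j,l)) else 0)"
      by (intro sum.cong) (use URi[OF that(1)] s0 kn in auto)
    also have "\<dots> = (\<Sum>l<k. U $$ (i,l) * (s l * V $$ (j,l)))" by (rule sum_lessThan_restrict[OF km])
    finally show ?thesis .
  qed
  have XK: "?X = A * K"
  proof (rule eq_matI)
    fix i j assume "i < dim_row (A * K)" "j < dim_col (A * K)"
    hence ij: "i < n" "j < m" using A K by auto
    have "(A * K) $$ (i,j) = (\<Sum>l<k. U $$ (i,l) * (s l * V $$ (j,l)))"
      using ij by (simp add: A_def K_def scalar_prod_def atLeast0LessThan)
    thus "?X $$ (i,j) = (A * K) $$ (i,j)" using Xi[OF ij] by simp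
  qed (use X A K in auto)
  have KL: "K * L = 1\<^sub>m k"
  proof (rule eq_matI)
    fix i j assume "i < dim_row (1\<^sub>m k)" "j < dim_col (1\<^sub>m k)"
    hence ij: "i < k" "j < k" by auto
    hence ij': "i < m" "j < m" using km by auto
    have "(K * L) $$ (i,j) = (\<Sum>q<m. s i / s j * (V $$ (q,i) * V $$ (q,j)))"
      using ij by (simp add: K_def L_def scalar_prod_def atLeast0LessThan mult.assoc)
    also have "\<dots> = s i / s j * (V\<^sup>T * V) $$ (i,j)"
      using mult_transpose_index[OF VD(2,2) ij'] VD(1) ij' by (simp add: sum_distrib_left)
    finally show "(K * L) $$ (i,j) = 1\<^sub>m k $$ (i,j)" using ij ij' s VD(3) by simp
  qed (auto simp: K_def L_def)
  have "A = ?X * L"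
    unfolding XK using assoc_mult_mat[OF A K L] A by (simp add: KL)
  hence "vec_space.rank n ?X = vec_space.rank n A"
    using rank_eq_of_factorizations[OF X A K XK L] by simp
  also have "\<dots> = k"
  proof (rule rank_orthonormal_columns[OF A])
    show "A\<^sup>T * A = 1\<^sub>m k"
    proof (rule eq_matI)
      fix i j assume "i < dim_row (1\<^sub>m k)" "j < dim_col (1\<^sub>m k)"
      hence ij: "i < k" "j < k" by auto
      hence ij': "i < n" "j < n" using kn by auto
      have "(A\<^sup>T * A) $$ (i,j) = (\<Sum>q<n. U $$ (q,i) * U $$ (q,j))"
        using ij by (simp add: A_def scalar_prod_def atLeast0LessThan)
      also have "\<dots> = (U\<^sup>T * U) $$ (i,j)"
        using mult_transpose_index[OF UD(2,2) ij'] UD(1) ij' by simp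
      finally show "(A\<^sup>T * A) $$ (i,j) = 1\<^sub>m k $$ (i,j)" using ij ij' UD(3) by simp
    qed (auto simp: A_def)
  qed
  finally show ?thesis .
qed

section \<open>The radial cone of the subdifferential of the conjugate\<close>

theorem lemma3p5:
  fixes n1 n2 r p :: nat
    and g :: "real mat \<Rightarrow> ereal"
    and X Y U V :: "real mat"
  assumes "n1 \<le> n2"
    and "g = (\<lambda>Z. ereal (nuclear_norm Z))"
    and "X \<in> carrier_mat n1 n2"
    and "Y \<in> carrier_mat n1 n2"
    and "Y \<in> subdifferential n1 n2 g X"
    and "(U, V) \<in> ordered_svds X \<inter> ordered_svds Y"
    and "r = vec_space.rank n1 X"
    and "p = card {i. i < n1 \<and> singvals Y ! i = 1}"
  shows "radial_cone (subdifferential n1 n2 (fenchel_conjugate n1 n2 g) Y) X =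
    {U * four_block_mat
           (four_block_mat A (B * C) (C\<^sup>T * B\<^sup>T) C) (0\<^sub>m p (n2 - p))
           (0\<^sub>m (n1 - p) p)                       (0\<^sub>m (n1 - p) (n2 - p))
       * V\<^sup>T
     | A B C. A \<in> sym_mats r \<and> B \<in> carrier_mat r (p - r) \<and> C \<in> psd_mats (p - r)}"
proof -
  note nm = assms(1)
  define s where "s = (\<lambda>i. singvals X ! i)"
  define y where "y = (\<lambda>i. singvals Y ! i)"
  have U: "U \<in> orthonormal_mats n1" and V: "V \<in> orthonormal_mats n2"
    using assms(3,6) by (auto simp: ordered_svds_def)
  note UD = orthonormal_matsD[OF U] and VD = orthonormal_matsD[OF V]
  have "X = U * Diag_singvals X * V\<^sup>T" "Y = U * Diag_singvals Y * V\<^sup>T"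
    using assms(6) unfolding ordered_svds_def by blast+
  moreover have "Diag_singvals X = rect_diag n1 n2 s" "Diag_singvals Y = rect_diag n1 n2 y"
    using assms(3,4) by (auto simp: Diag_singvals_def rect_diag_def s_def y_def)
  ultimately have X: "X = U * rect_diag n1 n2 s * V\<^sup>T" and Y: "Y = U * rect_diag n1 n2 y * V\<^sup>T"
    by simp_all
  have s0: "0 \<le> s i" and y0: "0 \<le> y i" if "i < n1" for i
    using singvals_nonneg[OF assms(3) that] singvals_nonneg[OF assms(4) that] by (auto simp: s_def y_def)
  have sub: "Y \<in> subdifferential n1 n2 (\<lambda>Z. ereal (nuclear_norm Z)) X" using assms(2,5) by simp
  have y_le: "y i \<le> 1" if "i < n1" for i
    by (rule subgradient_singvals(1)[OF nm U V X Y s0 sub that])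
  have y_eq: "y i = 1" if "i < n1" "0 < s i" for i
    by (rule subgradient_singvals(2)[OF nm U V X Y s0 sub that])
  have "{i. i < n1 \<and> y i = 1} = {..<p}"
    unfolding assms(8) y_def[symmetric]
  proof (rule downward_closed_eq_lessThan_card)
    fix i j assume j: "j \<in> {i. i < n1 \<and> y i = 1}" and ij: "i \<le> j"
    hence "y j \<le> y i" using singvals_antimono[OF assms(4) ij] by (simp add: y_def)
    thus "i \<in> {i. i < n1 \<and> y i = 1}" using j ij y_le[of i] by simp
  qed simp
  hence pset: "i < n1 \<and> y i = 1 \<longleftrightarrow> i < p" for i by auto
  define k where "k = card {i. i < n1 \<and> 0 < s i}"
  have "{i. i < n1 \<and> 0 < s i} = {..<k}"
    unfolding k_def
  proof (rule downward_closed_eq_lessThan_card)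
    fix i j assume j: "j \<in> {i. i < n1 \<and> 0 < s i}" and ij: "i \<le> j"
    hence "s j \<le> s i" using singvals_antimono[OF assms(3) ij] by (simp add: s_def)
    thus "i \<in> {i. i < n1 \<and> 0 < s i}" using j ij by simp
  qed simp
  hence kset: "i < n1 \<and> 0 < s i \<longleftrightarrow> i < k" for i by auto
  have kn: "k \<le> n1" and pn: "p \<le> n1" using kset[of n1] pset[of n1] by (auto simp: not_less)
  have sz: "s i = 0" if "k \<le> i" "i < n1" for i using kset[of i] s0[of i] that by auto
  have sk: "s i \<noteq> 0" if "i < k" for i using kset[of i] that by simp
  have "r = k" unfolding assms(7) X by (rule rank_orthonormal_rect_diag[OF U V kn nm sk sz])
  hence spos: "0 < s i" if "i < r" for i using kset[of i] that by simp
  have rp: "r \<le> p"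
    using kset[of p] pset[of p] y_eq[of p] \<open>r = k\<close> by (auto simp: not_less)
  have pm: "p \<le> n2" using pn nm by simp

  (* The singular values of Y are at most 1, so Y lies in the spectral unit ball. *)
  have "contraction n1 n2 (U * (rect_diag n1 n2 y * V\<^sup>T))"
  proof (rule contractionI[OF U])
    show c: "rect_diag n1 n2 y * V\<^sup>T \<in> carrier_mat n1 n2" by (rule mult_carrier_mat[OF rect_diag_carrier VD(2)])
    have "1\<^sub>m n1 \<in> orthonormal_mats n1" by (simp add: orthonormal_mats_def)
    from mult_mult_transpose_orthonormal[OF this V rect_diag_carrier]
    show "(rect_diag n1 n2 y * V\<^sup>T) * (rect_diag n1 n2 y * V\<^sup>T)\<^sup>T = mat_diag n1 (\<lambda>i. (y i)\<^sup>2)"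
      by (simp add: rect_diag_gram[OF nm] left_mult_one_mat[OF rect_diag_carrier])
    show "(y i)\<^sup>2 \<le> 1" if "i < n1" for i using y0[OF that] y_le[OF that] by (simp add: power_le_one)
  qed
  hence Ycon: "contraction n1 n2 Y"
    unfolding Y assoc_mult_mat[OF UD(1) rect_diag_carrier VD(2)] .
  let ?f = "\<lambda>S. U * corner n1 n2 p S * V\<^sup>T"
  have "subdifferential n1 n2 (fenchel_conjugate n1 n2 g) Y
    = {W \<in> carrier_mat n1 n2. nuclear_norm W \<le> frob_inner W Y}"
    unfolding assms(2) by (rule subdifferential_conjugate_nuclear_norm[OF Ycon])
  (* Both sides of the inequality are invariant under the coordinate change by U and V. *)
  also have "\<dots> = (\<lambda>M. U * M * V\<^sup>T) `
      {M \<in> carrier_mat n1 n2. nuclear_norm M \<le> frob_inner M (rect_diag n1 n2 y)}" (is "?W = ?h ` ?M")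
  proof -
    have mem: "?h M \<in> ?W \<longleftrightarrow> M \<in> ?M" if M: "M \<in> carrier_mat n1 n2" for M
      using mult_carrier_mat[OF mult_carrier_mat[OF UD(1) M] VD(2)] M
      by (simp add: Y frob_inner_orthonormal[OF U V M rect_diag_carrier] nuclear_norm_def
          singvals_orthonormal_mult[OF U V M])
    have surj: "\<exists>M \<in> carrier_mat n1 n2. W = ?h M" if W: "W \<in> carrier_mat n1 n2" for W
    proof
      have UW: "U\<^sup>T * W \<in> carrier_mat n1 n2" by (rule mult_carrier_mat[OF UD(2) W])
      show c: "U\<^sup>T * W * V \<in> carrier_mat n1 n2" by (rule mult_carrier_mat[OF UW VD(1)])
      have "?h (U\<^sup>T * W * V) = U * (U\<^sup>T * W * (V * V\<^sup>T))"
        unfolding assoc_mult_mat[OF UD(1) c VD(2)] assoc_mult_mat[OF UW VD(1) VD(2)] ..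
      also have "\<dots> = W" unfolding VD(4) right_mult_one_mat[OF UW] by (rule orthonormal_cancel(2)[OF U W])
      finally show "W = ?h (U\<^sup>T * W * V)" ..
    qed
    show ?thesis
    proof (intro equalityI subsetI)
      fix W assume W: "W \<in> ?W"
      then obtain M where M: "M \<in> carrier_mat n1 n2" "W = ?h M" using surj[of W] by blast
      thus "W \<in> ?h ` ?M" using W mem[OF M(1)] by blast
    next
      fix W assume "W \<in> ?h ` ?M"
      then obtain M where M: "M \<in> ?M" "W = ?h M" by blast
      thus "W \<in> ?W" using mem[of M] by blast
    qed
  qed
  also have "?M = corner n1 n2 p ` psd_mats p"
  proof (rule nuclear_norm_le_frob_inner_rect_diag[OF pn nm])
    show "y i = 1" if "i < p" for i using pset[of i] that by simp
    show "0 \<le> y i \<and> y i < 1" if "p \<le> i" "i < n1" for i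
      using pset[of i] y0[of i] y_le[of i] that by (simp add: order_less_le)
  qed
  also have "?h ` corner n1 n2 p ` psd_mats p = ?f ` psd_mats p" by (rule image_image)
  finally have Omega: "subdifferential n1 n2 (fenchel_conjugate n1 n2 g) Y = ?f ` psd_mats p" .
  have "rect_diag n1 n2 s = corner n1 n2 p (mat_diag p s)"
  proof (rule eq_matI)
    fix i j assume "i < dim_row (corner n1 n2 p (mat_diag p s))" "j < dim_col (corner n1 n2 p (mat_diag p s))"
    hence ij: "i < n1" "j < n2" using corner_carrier[OF mat_diag_dim pn pm, of s] by auto
    show "rect_diag n1 n2 s $$ (i,j) = corner n1 n2 p (mat_diag p s) $$ (i,j)"
      unfolding index_corner[OF mat_diag_dim pn pm ij] using ij sz[of i] rp \<open>r = k\<close> by auto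
  qed (use corner_carrier[OF mat_diag_dim pn pm, of s] in \<open>auto simp: rect_diag_def\<close>)
  hence Xf: "X = ?f (mat_diag p s)" using X by simp
  have "radial_cone (?f ` psd_mats p) (?f (mat_diag p s)) = ?f ` radial_cone (psd_mats p) (mat_diag p s)"
    by (rule radial_cone_image, rule orthonormal_corner_linear[OF UD(1) VD(1) _ mat_diag_dim pn pm])
      (simp add: psd_matsD(1))
  also have "radial_cone (psd_mats p) (mat_diag p s) =
    {four_block_mat A (B * C) (C\<^sup>T * B\<^sup>T) C
     | A B C. A \<in> sym_mats r \<and> B \<in> carrier_mat r (p - r) \<and> C \<in> psd_mats (p - r)}"
    by (rule radial_cone_psd_mats[OF rp spos]) (use sz \<open>r = k\<close> pn in auto)
  finally show ?thesis unfolding Omega Xf corner_def by blast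
qed

end
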